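(* There exist a constant $c>0$, an integer $k_0\ge 2$, and, for each integer $k\ge k_0$, a set $U_k$ of $k$-permutations such that $|U_k|/k!\to 1$ as $k\to\infty$ and, for every $k\ge k_0$, the limit $L(U_k)=\lim_{n\to\infty}S_n(U_k)^{1/n}$ exists (as a finite real number) and satisfies $$L(U_k)\ \ge\ 2^{c\,(k/\log k)^{1/4}}.$$
   Context: Write $[n]=\{1,\dots,n\}$. An $n$-permutation is a permutation of $[n]$. An $n$-permutation $\sigma$ contains a $k$-permutation $\pi$ if there are integers $1\le x_1<x_2<\dots<x_k\le n$ such that for all $1\le i,j\le k$ we have $\sigma(x_i)<\sigma(x_j)$ if and only if $\pi(i)<\pi(j)$; otherwise $\sigma$ avoids $\pi$. For a set $U$ of permutations, $S_n(U)$ is the number of $n$-permutations that avoid every permutation in $U$. Logarithms are base $2$. *)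

theory Defs
  imports Complex_Main "HOL-Combinatorics.Permutations"
begin

(* An n-permutation is a function that permutes {1..n}; it is the identity outside {1..n}, so the
   functions correspond one-to-one to the n-permutations. The function does not determine its
   length (the identity permutes every {1..n}), so lengths are passed explicitly. *)

definition contains_perm :: "nat \<Rightarrow> (nat \<Rightarrow> nat) \<Rightarrow> nat \<Rightarrow> (nat \<Rightarrow> nat) \<Rightarrow> bool" where
  "contains_perm n \<sigma> k \<pi> \<longleftrightarrow>
     (\<exists>x :: nat \<Rightarrow> nat. strict_mono_on {1..k} x \<and> x ` {1..k} \<subseteq> {1..n} \<and>
        (\<forall>i\<in>{1..k}. \<forall>j\<in>{1..k}. \<sigma> (x i) < \<sigma> (x j) \<longleftrightarrow> \<pi> i < \<pi> j))"

(* The number of n-permutations that avoid every member of a set U of k-permutations. *)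
definition num_avoiders :: "nat \<Rightarrow> (nat \<Rightarrow> nat) set \<Rightarrow> nat \<Rightarrow> nat" where
  "num_avoiders k U n = card {\<sigma>. \<sigma> permutes {1..n} \<and> (\<forall>\<pi>\<in>U. \<not> contains_perm n \<sigma> k \<pi>)}"

end

theory Submission
  imports Defs "HOL-Library.FuncSet" "HOL-Real_Asymp.Real_Asymp"
begin

text \<open>
  A random \<open>k\<close>-permutation meets every box of a division of the square into \<open>l \<times> l\<close> equal boxes
  when \<open>l\<close> is a small multiple of \<open>sqrt (k / log k)\<close>, and it is sum-indecomposable; \<open>U k\<close> consists of
  such permutations. Direct sums preserve avoidance of \<open>U k\<close>, so the growth rate exists by Fekete's
  lemma, is finite by the Marcus--Tardos theorem, and is at least each \<open>S\<^sub>N(U k)\<^bsup>1/N\<^esup>\<close>. For the lower bound it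
  suffices to find one \<open>N\<close> with many \<open>N\<close>-permutations that have no grid of size \<open>l\<close>.

  Let \<open>N = 2 ^ r\<close> and discard every product of two dyadic intervals independently with probability
  \<open>1 / (4 r + 5)\<close>; the cells outside all discarded products form a matrix. A cell lies in
  \<open>(r + 1)\<^sup>2\<close> products only, so the expected density is \<open>exp (-O(r))\<close> with a small constant, which leaves \<open>2\<close> to the power
  \<open>\<Omega>(r)\<close> cells per row. In a grid of size \<open>l\<close> the smallest dyadic intervals around the \<open>l\<close> row
  intervals are distinct, and so are those around the columns; all \<open>l\<^sup>2\<close> products must have been kept, which is
  unlikely for \<open>l\<close> of order \<open>r\<^sup>2\<close>. Choosing \<open>N\<close> cells of the matrix and expanding rows and columns into
  increasing sequences yields the required permutations.
\<close>

section \<open>Grids and the Marcus--Tardos bound\<close>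

text \<open>A grid of size \<open>l\<close> in \<open>P\<close> amounts to \<open>l\<close> disjoint row intervals and \<open>l\<close> disjoint column
  intervals such that each of the \<open>l\<^sup>2\<close> boxes meets \<open>P\<close>: the all-ones matrix is an interval
  minor of \<open>P\<close>. The intervals are the hulls of the coordinates of the chosen points.\<close>

definition grid_at :: "nat \<Rightarrow> (nat \<times> nat) set \<Rightarrow> (nat \<Rightarrow> nat \<Rightarrow> nat \<times> nat) \<Rightarrow> bool" where
  "grid_at l P p \<longleftrightarrow> (\<forall>i<l. \<forall>j<l. p i j \<in> P) \<and>
     (\<forall>i<l. \<forall>i'<l. \<forall>j<l. \<forall>j'<l.
        (i < i' \<longrightarrow> fst (p i j) < fst (p i' j')) \<and> (j < j' \<longrightarrow> snd (p i j) < snd (p i' j')))"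

definition grid :: "nat \<Rightarrow> (nat \<times> nat) set \<Rightarrow> bool" where
  "grid l P \<longleftrightarrow> (\<exists>p. grid_at l P p)"

definition perm_points :: "nat \<Rightarrow> (nat \<Rightarrow> nat) \<Rightarrow> (nat \<times> nat) set" where
  "perm_points n \<sigma> = (\<lambda>x. (x, \<sigma> x)) ` {1..n}"

section \<open>Grids under monotone maps, transposition and pattern containment\<close>

lemma gridI:
  assumes "\<And>i j. i < l \<Longrightarrow> j < l \<Longrightarrow> p i j \<in> P"
    and "\<And>i i' j j'. i < i' \<Longrightarrow> i' < l \<Longrightarrow> j < l \<Longrightarrow> j' < l \<Longrightarrow> fst (p i j) < fst (p i' j')"
    and "\<And>i i' j j'. j < j' \<Longrightarrow> i < l \<Longrightarrow> i' < l \<Longrightarrow> j' < l \<Longrightarrow> snd (p i j) < snd (p i' j')"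
  shows "grid l P"
proof -
  have "grid_at l P p"
    unfolding grid_at_def by (intro conjI allI impI) (erule assms; assumption)+
  then show ?thesis unfolding grid_def by blast
qed

lemma grid_atD:
  assumes "grid_at l P p"
  shows "i < l \<Longrightarrow> j < l \<Longrightarrow> p i j \<in> P"
    and "i < i' \<Longrightarrow> i' < l \<Longrightarrow> j < l \<Longrightarrow> j' < l \<Longrightarrow> fst (p i j) < fst (p i' j')"
    and "j < j' \<Longrightarrow> i < l \<Longrightarrow> i' < l \<Longrightarrow> j' < l \<Longrightarrow> snd (p i j) < snd (p i' j')"
  using assms less_trans unfolding grid_at_def by simp_all

lemma grid_subset: "grid l P \<Longrightarrow> P \<subseteq> Q \<Longrightarrow> grid l Q"
  unfolding grid_def grid_at_def by (elim exE conjE, rule exI, rule conjI) auto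

text \<open>A monotone map reflects strict inequalities, so any choice of preimages of the grid
  points is again a grid. Contractions such as division by \<open>B\<close> therefore preserve
  grid-freeness.\<close>

lemma grid_mono_image:
  assumes "mono f" "mono g" "grid l (map_prod f g ` P)"
  shows "grid l P"
proof -
  from assms(3) obtain p where "grid_at l (map_prod f g ` P) p" unfolding grid_def by blast
  note p = grid_atD(1)[OF this] and p1 = grid_atD(2)[OF this] and p2 = grid_atD(3)[OF this]
  have "\<forall>i j. \<exists>z. i < l \<longrightarrow> j < l \<longrightarrow> z \<in> P \<and> p i j = map_prod f g z"
  proof (intro allI)
    fix i j
    show "\<exists>z. i < l \<longrightarrow> j < l \<longrightarrow> z \<in> P \<and> p i j = map_prod f g z"
      using p[of i j] by (cases "i < l \<and> j < l") auto
  qed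
  then obtain q where q: "\<And>i j. i < l \<Longrightarrow> j < l \<Longrightarrow> q i j \<in> P \<and> p i j = map_prod f g (q i j)"
    by metis
  have lt: "h x < h y \<Longrightarrow> x < y" if "mono h" for h :: "nat \<Rightarrow> nat" and x y
    using that by (meson leD monoD not_less)
  show ?thesis
  proof (rule gridI[of _ q])
    fix i j assume "i < l" "j < l" then show "q i j \<in> P" using q by blast
  next
    fix i i' j j' assume a: "i < i'" "i' < l" "j < l" "j' < l"
    show "fst (q i j) < fst (q i' j')"
      using p1[OF a] q[of i j] q[of i' j'] a by (auto intro!: lt[OF assms(1)])
  next
    fix i i' j j' assume a: "j < j'" "i < l" "i' < l" "j' < l"
    show "snd (q i j) < snd (q i' j')"
      using p2[OF a] q[of i j] q[of i' j'] a by (auto intro!: lt[OF assms(2)])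
  qed
qed

lemma grid_swap:
  assumes "grid l (prod.swap ` P)" shows "grid l P"
proof -
  from assms obtain p where "grid_at l (prod.swap ` P) p" unfolding grid_def by blast
  note p = grid_atD(1)[OF this] and p1 = grid_atD(2)[OF this] and p2 = grid_atD(3)[OF this]
  show ?thesis
  proof (rule gridI[of _ "\<lambda>i j. prod.swap (p j i)"])
    fix i j assume "i < l" "j < l"
    then have "p j i \<in> prod.swap ` P" by (intro p)
    then show "prod.swap (p j i) \<in> P" by auto
  qed (use p1 p2 in \<open>simp_all\<close>)
qed

text \<open>An occurrence of \<open>\<pi>\<close> carries positions and values over in order, so the
  grid is copied along it. In contrapositive form, a permutation without a grid of size
  \<open>l\<close> avoids all patterns that have one.\<close>

lemma grid_contains_perm:
  assumes "contains_perm n \<sigma> k \<pi>" "grid l (perm_points k \<pi>)"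
  shows "grid l (perm_points n \<sigma>)"
proof -
  from assms(1) obtain x where x: "strict_mono_on {1..k} x" "x ` {1..k} \<subseteq> {1..n}"
    "\<And>i j. i\<in>{1..k} \<Longrightarrow> j\<in>{1..k} \<Longrightarrow> \<sigma> (x i) < \<sigma> (x j) \<longleftrightarrow> \<pi> i < \<pi> j"
    unfolding contains_perm_def by blast
  from assms(2) obtain p where "grid_at l (perm_points k \<pi>) p" unfolding grid_def by blast
  note p = grid_atD(1)[OF this] and p1 = grid_atD(2)[OF this] and p2 = grid_atD(3)[OF this]
  have f: "fst (p i j) \<in> {1..k} \<and> snd (p i j) = \<pi> (fst (p i j))" if "i < l" "j < l" for i j
    using p[OF that] by (auto simp: perm_points_def)
  show ?thesis
  proof (rule gridI[of _ "\<lambda>i j. (x (fst (p i j)), \<sigma> (x (fst (p i j))))"])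
    fix i j assume "i < l" "j < l"
    then show "(x (fst (p i j)), \<sigma> (x (fst (p i j)))) \<in> perm_points n \<sigma>"
      using f x(2) unfolding perm_points_def by blast
  next
    fix i i' j j' assume a: "i < i'" "i' < l" "j < l" "j' < l"
    then show "fst (x (fst (p i j)), \<sigma> (x (fst (p i j)))) < fst (x (fst (p i' j')), \<sigma> (x (fst (p i' j'))))"
      using p1[OF a] f[of i j] f[of i' j'] x(1) by (auto simp: strict_mono_on_def)
  next
    fix i i' j j' assume a: "j < j'" "i < l" "i' < l" "j' < l"
    then show "snd (x (fst (p i j)), \<sigma> (x (fst (p i j)))) < snd (x (fst (p i' j')), \<sigma> (x (fst (p i' j'))))"
      using p2[OF a] f[of i j] f[of i' j'] x(3)[of "fst (p i j)" "fst (p i' j')"] by auto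
  qed
qed

text \<open>From row interval \<open>i\<close> take the grid point in column interval
  \<open>\<pi> i\<close>; grid indices start at 0 and permutations at 1, hence the shifts. So
  avoiding a single \<open>k\<close>-permutation already excludes grids of size
  \<open>k\<close>.\<close>

lemma contains_perm_of_grid:
  assumes "grid k (perm_points n \<sigma>)" "\<pi> permutes {1..k}"
  shows "contains_perm n \<sigma> k \<pi>"
proof -
  from assms(1) obtain p where "grid_at k (perm_points n \<sigma>) p" unfolding grid_def by blast
  note p = grid_atD(1)[OF this] and p1 = grid_atD(2)[OF this] and p2 = grid_atD(3)[OF this]
  define x where "x i = fst (p (i - 1) (\<pi> i - 1))" for i
  have \<pi>: "\<pi> i \<in> {1..k}" if "i \<in> {1..k}" for i
    using permutes_in_image[OF assms(2)] that by blast
  have b: "i - 1 < k" "\<pi> i - 1 < k" if "i \<in> {1..k}" for i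
    using \<pi>[OF that] that by auto
  have \<sigma>: "x i \<in> {1..n}" "\<sigma> (x i) = snd (p (i - 1) (\<pi> i - 1))" if "i \<in> {1..k}" for i
    using p[OF b[OF that]] by (auto simp: perm_points_def x_def)
  have lt: "\<sigma> (x i) < \<sigma> (x j)" if "i \<in> {1..k}" "j \<in> {1..k}" "\<pi> i < \<pi> j" for i j
    unfolding \<sigma>(2)[OF that(1)] \<sigma>(2)[OF that(2)]
    using that b[OF that(1)] b[OF that(2)] \<pi>[OF that(1)] by (intro p2) auto
  show ?thesis
    unfolding contains_perm_def
  proof (intro exI[of _ x] conjI ballI)
    show "strict_mono_on {1..k} x"
    proof (rule strict_mono_onI)
      fix r s assume "r \<in> {1..k}" "s \<in> {1..k}" "r < s"
      then show "x r < x s" using b[of r] b[of s] unfolding x_def by (intro p1) auto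
    qed
    show "x ` {1..k} \<subseteq> {1..n}" using \<sigma> by blast
    fix i j assume ij: "i \<in> {1..k}" "j \<in> {1..k}"
    show "\<sigma> (x i) < \<sigma> (x j) \<longleftrightarrow> \<pi> i < \<pi> j"
    proof (cases "i = j")
      case False
      then have "\<pi> i \<noteq> \<pi> j" using permutes_inj[OF assms(2)] by (meson injD)
      then show ?thesis using lt ij by (metis linorder_neqE_nat not_less_iff_gr_or_eq)
    qed simp
  qed
qed

lemma ex_increasing_enum:
  fixes R :: "nat set"
  assumes "finite R" "k \<le> card R"
  obtains f where "\<And>i. i < k \<Longrightarrow> f i \<in> R" "\<And>i j. i < j \<Longrightarrow> j < k \<Longrightarrow> f i < f j"
proof (rule that[of "\<lambda>i. sorted_list_of_set R ! i"])
  fix i assume "i < k"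
  then show "sorted_list_of_set R ! i \<in> R"
    using assms by (metis length_sorted_list_of_set less_le_trans nth_mem set_sorted_list_of_set)
next
  fix i j assume "i < j" "j < k"
  then show "sorted_list_of_set R ! i < sorted_list_of_set R ! j"
    using assms strict_sorted_list_of_set[of R] by (simp add: sorted_wrt_iff_nth_less)
qed

section \<open>Contraction to blocks and the linear bound on grid-free sets\<close>

definition block :: "nat \<Rightarrow> (nat \<times> nat) set \<Rightarrow> nat \<Rightarrow> nat \<Rightarrow> (nat \<times> nat) set" where
  "block B P u v = {z \<in> P. fst z div B = u \<and> snd z div B = v}"

lemma block_subset:
  assumes "B > 0"
  shows "block B P u v \<subseteq> {u * B..<u * B + B} \<times> {v * B..<v * B + B}"
proof -
  have "x \<in> {x div B * B..<x div B * B + B}" for x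
  proof -
    have "x = x div B * B + x mod B" by simp
    then have "x < x div B * B + B" using mod_less_divisor[OF assms, of x] by linarith
    then show ?thesis by simp
  qed
  then show ?thesis unfolding block_def by fastforce
qed

text \<open>If too many blocks in one strip were tall, \<open>k\<close> of them would occupy the same \<open>k\<close> rows by the
  pigeonhole principle, and these rows would form a grid.\<close>

lemma card_tall_blocks:
  assumes "B > 0" "\<not> grid k P"
  shows "card {v. v < n \<and> k \<le> card (fst ` block B P u v)} \<le> k * 2 ^ B"
proof (rule ccontr)
  define V where "V = {v. v < n \<and> k \<le> card (fst ` block B P u v)}"
  assume "\<not> ?thesis"
  then have big: "card V > k * 2 ^ B" unfolding V_def by simp
  have fV: "finite V" unfolding V_def by simp
  have sub: "fst ` block B P u v \<subseteq> {u * B..<u * B + B}" for v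
    using block_subset[OF assms(1), of P u v] by fastforce
  have "(\<lambda>v. fst ` block B P u v) \<in> V \<rightarrow> Pow {u * B..<u * B + B}"
    using sub by blast
  from pigeonhole_card[OF this fV] obtain R where R: "R \<in> Pow {u * B..<u * B + B}"
    and "card V \<le> card ((\<lambda>v. fst ` block B P u v) -` {R} \<inter> V) * card (Pow {u * B..<u * B + B})"
    by auto
  then have "card V \<le> card ((\<lambda>v. fst ` block B P u v) -` {R} \<inter> V) * 2 ^ B"
    by (simp add: card_Pow)
  then have "k * 2 ^ B < card ((\<lambda>v. fst ` block B P u v) -` {R} \<inter> V) * 2 ^ B"
    using big by (rule less_le_trans[rotated])
  then have kV: "k < card ((\<lambda>v. fst ` block B P u v) -` {R} \<inter> V)" by simp
  then obtain v0 where "v0 \<in> (\<lambda>v. fst ` block B P u v) -` {R} \<inter> V"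
    by (metis card.empty ex_in_conv not_less0)
  then have kR: "k \<le> card R" unfolding V_def by auto
  have "finite R" using R by (auto intro: finite_subset)
  from ex_increasing_enum[OF this kR] obtain f where f: "\<And>i. i < k \<Longrightarrow> f i \<in> R"
    "\<And>i j. i < j \<Longrightarrow> j < k \<Longrightarrow> f i < f j" by metis
  have "finite ((\<lambda>v. fst ` block B P u v) -` {R} \<inter> V)" using fV by blast
  from ex_increasing_enum[OF this less_imp_le[OF kV]] obtain g where
    g: "\<And>i. i < k \<Longrightarrow> g i \<in> (\<lambda>v. fst ` block B P u v) -` {R} \<inter> V"
    "\<And>i j. i < j \<Longrightarrow> j < k \<Longrightarrow> g i < g j" by metis
  have "\<forall>i j. \<exists>z. i < k \<longrightarrow> j < k \<longrightarrow> z \<in> block B P u (g j) \<and> fst z = f i"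
  proof (intro allI)
    fix i j
    show "\<exists>z. i < k \<longrightarrow> j < k \<longrightarrow> z \<in> block B P u (g j) \<and> fst z = f i"
    proof (cases "i < k \<and> j < k")
      case True
      then have "f i \<in> fst ` block B P u (g j)" using f(1)[of i] g(1)[of j] by auto
      then show ?thesis by auto
    qed auto
  qed
  then obtain z where z: "\<And>i j. i < k \<Longrightarrow> j < k \<Longrightarrow> z i j \<in> block B P u (g j) \<and> fst (z i j) = f i"
    by metis
  have "grid k P"
  proof (rule gridI[of _ z])
    fix i j assume "i < k" "j < k" then show "z i j \<in> P" using z by (auto simp: block_def)
  next
    fix i i' j j' assume "i < i'" "i' < k" "j < k" "j' < k"
    then show "fst (z i j) < fst (z i' j')" using z f by auto
  next
    fix i i' j j' assume a: "j < j'" "i < k" "i' < k" "j' < k"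
    then have "snd (z i j) div B < snd (z i' j') div B"
      using z[of i j] z[of i' j'] g(2)[of j j'] by (auto simp: block_def)
    then show "snd (z i j) < snd (z i' j')"
      by (meson div_le_mono leD not_less)
  qed
  then show False using assms(2) by blast
qed

lemma mono_div: "mono (\<lambda>x::nat. x div B)"
  by (simp add: mono_def div_le_mono)

lemma card_Sigma_le:
  assumes "finite A" "\<And>a. a \<in> A \<Longrightarrow> finite (B a)" "\<And>a. a \<in> A \<Longrightarrow> card (B a) \<le> c"
  shows "card (Sigma A B) \<le> card A * c"
  using assms sum_bounded_above[of A "\<lambda>a. card (B a)" c] by simp

text \<open>The Marcus-Tardos recursion. A block with fewer than \<open>k\<close> occupied rows and
  fewer than \<open>k\<close> occupied columns has at most \<open>(k - 1)\<^sup>2\<close> points;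
  the tall and the wide blocks are few, and each has at most \<open>B\<^sup>2\<close>
  points.\<close>

lemma card_le_of_block_sizes:
  assumes B: "B > 0" and P: "P \<subseteq> {..<n * B} \<times> {..<n * B}" and g: "\<not> grid k P" and k: "k > 0"
  defines "Q \<equiv> map_prod (\<lambda>x. x div B) (\<lambda>x. x div B) ` P"
  shows "card P \<le> (k - 1)\<^sup>2 * card Q + 2 * n * k * 2 ^ B * B\<^sup>2"
proof -
  define T where "T = (SIGMA u:{..<n}. {v. v < n \<and> k \<le> card (fst ` block B P u v)})"
  \<comment> \<open>Wide blocks are indexed column first, so that they are the tall blocks of the
    transposed set.\<close>
  define W where "W = (SIGMA v:{..<n}. {u. u < n \<and> k \<le> card (snd ` block B P u v)})"
  have fP: "finite P" by (rule finite_subset[OF P]) simp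
  then have fQ: "finite Q" unfolding Q_def by blast
  have cT: "card T \<le> n * (k * 2 ^ B)"
    unfolding T_def using card_tall_blocks[OF B g, of n]
    by (intro card_Sigma_le[where A = "{..<n}", simplified]) auto
  have sw: "snd ` block B P u v = fst ` block B (prod.swap ` P) v u" for u v
    unfolding block_def by force
  have gs: "\<not> grid k (prod.swap ` P)" using g grid_swap by blast
  have cW: "card W \<le> n * (k * 2 ^ B)"
    unfolding W_def sw using card_tall_blocks[OF B gs, of n]
    by (intro card_Sigma_le[where A = "{..<n}", simplified]) auto
  have fT: "finite T" "finite W" unfolding T_def W_def by auto
  have Qn: "Q \<subseteq> {..<n} \<times> {..<n}"
    unfolding Q_def using P B by (force simp: less_mult_imp_div_less)
  have cb: "card (block B P u v) \<le> B\<^sup>2" for u v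
    using card_mono[OF _ block_subset[OF B, of P u v]] by (simp add: power2_eq_square)
  have fb: "finite (block B P u v)" for u v using fP unfolding block_def by auto
  have each: "card (block B P u v) \<le> (k - 1)\<^sup>2 + (if (u, v) \<in> T then B\<^sup>2 else 0)
      + (if (v, u) \<in> W then B\<^sup>2 else 0)" if "(u, v) \<in> Q" for u v
  proof (cases "(u, v) \<in> T \<or> (v, u) \<in> W")
    case True
    then show ?thesis using cb[of u v] by auto
  next
    case False
    then have "card (fst ` block B P u v) \<le> k - 1" "card (snd ` block B P u v) \<le> k - 1"
      using that Qn unfolding T_def W_def by auto
    moreover have "block B P u v \<subseteq> fst ` block B P u v \<times> snd ` block B P u v"
      by force
    then have "card (block B P u v) \<le> card (fst ` block B P u v) * card (snd ` block B P u v)"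
      using card_mono[of "fst ` block B P u v \<times> snd ` block B P u v"] fb
      by (simp add: card_cartesian_product)
    ultimately have "card (block B P u v) \<le> (k - 1) * (k - 1)"
      using mult_le_mono order.trans by blast
    then show ?thesis by (simp add: power2_eq_square)
  qed
  have "P = (\<Union>q\<in>Q. block B P (fst q) (snd q))"
    unfolding Q_def block_def by force
  then have "card P \<le> (\<Sum>q\<in>Q. card (block B P (fst q) (snd q)))"
    using card_UN_le[OF fQ, of "\<lambda>q. block B P (fst q) (snd q)"] by simp
  also have "\<dots> \<le> (\<Sum>q\<in>Q. (k - 1)\<^sup>2 + (if q \<in> T then B\<^sup>2 else 0) + (if prod.swap q \<in> W then B\<^sup>2 else 0))"
  proof (rule sum_mono)
    fix q assume "q \<in> Q"
    then show "card (block B P (fst q) (snd q)) \<le>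
        (k - 1)\<^sup>2 + (if q \<in> T then B\<^sup>2 else 0) + (if prod.swap q \<in> W then B\<^sup>2 else 0)"
      using each[of "fst q" "snd q"] by (simp add: prod.swap_def)
  qed
  also have "\<dots> = (k - 1)\<^sup>2 * card Q + B\<^sup>2 * card (Q \<inter> T) + B\<^sup>2 * card {q \<in> Q. prod.swap q \<in> W}"
    using fQ by (simp add: sum.distrib sum.If_cases Int_def)
  also have "\<dots> \<le> (k - 1)\<^sup>2 * card Q + B\<^sup>2 * (n * (k * 2 ^ B)) + B\<^sup>2 * (n * (k * 2 ^ B))"
  proof -
    have "card (Q \<inter> T) \<le> n * (k * 2 ^ B)"
      using card_mono[of T "Q \<inter> T"] fT cT by simp
    moreover have "card {q \<in> Q. prod.swap q \<in> W} \<le> card W"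
      using fT by (intro card_inj_on_le[of prod.swap]) (auto simp: inj_on_def)
    ultimately show ?thesis using cW by (intro add_mono mult_le_mono order.refl) auto
  qed
  also have "\<dots> = (k - 1)\<^sup>2 * card Q + 2 * n * k * 2 ^ B * B\<^sup>2"
    by (simp add: algebra_simps)
  finally show ?thesis .
qed

text \<open>Strong induction along the block recursion: contraction preserves grid-freeness and
  divides the side by \<open>B\<close>, while the number of points grows back by a factor
  \<open>(k - 1)\<^sup>2\<close> plus a linear term. Since \<open>B\<close> is at least
  \<open>(k - 1)\<^sup>2 + 1\<close>, a linear bound reproduces itself.\<close>

lemma grid_free_linear:
  assumes k: "k > 0"
  obtains c where "\<And>j P. P \<subseteq> {..<2 ^ j} \<times> {..<2 ^ j} \<Longrightarrow> \<not> grid k P \<Longrightarrow> card P \<le> c * 2 ^ j"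
proof -
  \<comment> \<open>A power of 2, so that contraction leads to a smaller dyadic square.\<close>
  define B :: nat where "B = 2 ^ (2 * k)"
  \<comment> \<open>The first summand is the contribution of tall and wide blocks per strip; the
    summand \<open>B\<close> covers the base case of squares with side below
    \<open>B\<close>.\<close>
  define c where "c = 2 * k * 2 ^ B * B\<^sup>2 + B"
  have B0: "B > 0" unfolding B_def by simp
  have "k - 1 < 2 ^ k" using less_exp[of k] by linarith
  then have "(k - 1)\<^sup>2 < (2 ^ k)\<^sup>2" by (intro power_strict_mono) auto
  then have kB: "(k - 1)\<^sup>2 + 1 \<le> B" unfolding B_def by (simp add: power_mult mult.commute)
  have "card P \<le> c * 2 ^ j" if "P \<subseteq> {..<2 ^ j} \<times> {..<2 ^ j}" "\<not> grid k P" for j P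
    using that
  proof (induction j arbitrary: P rule: less_induct)
    case (less j)
    show ?case
    proof (cases "j < 2 * k")
      case True
      have "card P \<le> 2 ^ j * 2 ^ j"
        using card_mono[OF _ less.prems(1)] by (simp add: card_cartesian_product)
      also have "\<dots> \<le> B * 2 ^ j" using True unfolding B_def by (intro mult_le_mono power_increasing) auto
      also have "\<dots> \<le> c * 2 ^ j" unfolding c_def by simp
      finally show ?thesis .
    next
      case False
      define i where "i = j - 2 * k"
      have ji: "(2::nat) ^ j = 2 ^ i * B" "i < j"
        using False k unfolding i_def B_def by (simp_all flip: power_add)
      define Q where "Q = map_prod (\<lambda>x. x div B) (\<lambda>x. x div B) ` P"
      have PB: "P \<subseteq> {..<2 ^ i * B} \<times> {..<2 ^ i * B}" using less.prems(1) ji by simp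
      have "Q \<subseteq> {..<2 ^ i} \<times> {..<2 ^ i}"
        unfolding Q_def using PB by (force simp: less_mult_imp_div_less)
      moreover have "\<not> grid k Q"
        using grid_mono_image[OF mono_div mono_div] less.prems(2) unfolding Q_def by blast
      ultimately have Q: "card Q \<le> c * 2 ^ i" using less.IH ji(2) by blast
      have "card P \<le> (k - 1)\<^sup>2 * card Q + 2 * 2 ^ i * k * 2 ^ B * B\<^sup>2"
        using card_le_of_block_sizes[OF B0 PB less.prems(2) k] unfolding Q_def by simp
      also have "\<dots> \<le> (k - 1)\<^sup>2 * (c * 2 ^ i) + c * 2 ^ i"
        using Q unfolding c_def by (intro add_mono mult_le_mono2) (auto simp: algebra_simps)
      also have "\<dots> = ((k - 1)\<^sup>2 + 1) * (c * 2 ^ i)" by simp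
      also have "\<dots> \<le> B * (c * 2 ^ i)" using kB by (intro mult_le_mono) auto
      finally show ?thesis using ji by (simp add: algebra_simps)
    qed
  qed
  then show ?thesis using that by blast
qed

text \<open>Klazar's argument: a grid-free set is determined by its contraction by 2, which is grid-free and
  hence has linearly many cells, and by one of finitely many choices per cell.\<close>

lemma card_grid_free_sets:
  assumes k: "k > 0"
  obtains C where "\<And>j. card {P. P \<subseteq> {..<2 ^ j} \<times> {..<2 ^ j} \<and> \<not> grid k P} \<le> 2 ^ (C * 2 ^ j)"
proof -
  obtain c where c: "\<And>j P. P \<subseteq> {..<2 ^ j} \<times> {..<2 ^ j} \<Longrightarrow> \<not> grid k P \<Longrightarrow> card P \<le> c * 2 ^ j"
    using grid_free_linear[OF k] by blast
  define F where "F j = {P. P \<subseteq> {..<2 ^ j} \<times> {..<2 ^ j} \<and> \<not> grid k P}" for j :: nat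
  \<comment> \<open>\<open>E Q\<close> consists of the four points that halving sends to each cell
    of \<open>Q\<close>, so \<open>P\<close> is a subset of \<open>E Q\<close> when \<open>Q\<close>
    is its contraction.\<close>
  define E :: "(nat \<times> nat) set \<Rightarrow> (nat \<times> nat) set"
    where "E Q = (\<lambda>(u, v). (2 * fst u + fst v, 2 * snd u + snd v)) ` (Q \<times> ({0,1} \<times> {0,1}))" for Q
  have fF: "finite (F j)" for j
    unfolding F_def by (rule finite_subset[of _ "Pow ({..<2 ^ j} \<times> {..<2 ^ j})"]) auto
  \<comment> \<open>The exponents added at each doubling, \<open>4 * c * 2 ^ j\<close>, form a
    geometric series; the extra 1 in the coefficient pays for the base case.\<close>
  have "card (F j) \<le> 2 ^ ((4 * c + 1) * 2 ^ j)" for j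
  proof (induction j)
    case 0
    have "F 0 \<subseteq> Pow {(0, 0)}" unfolding F_def by auto
    then have "card (F 0) \<le> 2" using card_mono[of "Pow {(0::nat, 0::nat)}" "F 0"] by (simp add: card_Pow)
    also have "(2::nat) \<le> 2 ^ (4 * c + 1)" by simp
    finally show ?case by simp
  next
    case (Suc j)
    have "F (Suc j) \<subseteq> (\<Union>Q\<in>F j. Pow (E Q))"
    proof
      fix P assume P: "P \<in> F (Suc j)"
      define Q where "Q = map_prod (\<lambda>x. x div 2) (\<lambda>x. x div 2) ` P"
      have "Q \<in> F j"
        using P grid_mono_image[OF mono_div mono_div, of k 2 2 P] unfolding F_def Q_def by force
      moreover have "P \<subseteq> E Q"
      proof
        fix z assume z: "z \<in> P"
        have "z = (\<lambda>(u, v). (2 * fst u + fst v, 2 * snd u + snd v))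
           ((fst z div 2, snd z div 2), (fst z mod 2, snd z mod 2))" by simp
        moreover have "(fst z div 2, snd z div 2) \<in> Q"
          unfolding Q_def using z by force
        ultimately show "z \<in> E Q" unfolding E_def
          by (intro rev_image_eqI[of "((fst z div 2, snd z div 2), (fst z mod 2, snd z mod 2))"]) auto
      qed
      ultimately show "P \<in> (\<Union>Q\<in>F j. Pow (E Q))" by blast
    qed
    moreover have finE: "finite (E Q) \<and> card (E Q) \<le> 4 * c * 2 ^ j" if "Q \<in> F j" for Q
    proof -
      have fQ: "finite Q" using that unfolding F_def
        by (auto intro: finite_subset[of _ "{..<2 ^ j} \<times> {..<2 ^ j}"])
      have "card (E Q) \<le> card (Q \<times> ({0::nat,1} \<times> {0::nat,1}))"
        unfolding E_def using fQ by (intro card_image_le) auto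
      also have "\<dots> = 4 * card Q" by (simp add: card_cartesian_product)
      also have "\<dots> \<le> 4 * (c * 2 ^ j)" using c that unfolding F_def by auto
      finally show ?thesis using fQ unfolding E_def by auto
    qed
    ultimately have "card (F (Suc j)) \<le> card (\<Union>Q\<in>F j. Pow (E Q))"
      using fF by (intro card_mono) auto
    also have "\<dots> \<le> (\<Sum>Q\<in>F j. card (Pow (E Q)))" using fF by (rule card_UN_le)
    also have "\<dots> \<le> (\<Sum>Q\<in>F j. 2 ^ (4 * c * 2 ^ j))"
      using finE by (intro sum_mono) (simp add: card_Pow)
    also have "\<dots> \<le> 2 ^ ((4 * c + 1) * 2 ^ j) * 2 ^ (4 * c * 2 ^ j)" using Suc by simp
    also have "\<dots> \<le> 2 ^ ((4 * c + 1) * 2 ^ Suc j)"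
      unfolding power_add[symmetric] by (intro power_increasing) (auto simp: algebra_simps)
    finally show ?case .
  qed
  then show ?thesis using that unfolding F_def by blast
qed

section \<open>Existence of the growth rate\<close>

text \<open>Sum-indecomposability: no proper prefix of positions is mapped onto a prefix of values.\<close>

definition indec :: "nat \<Rightarrow> (nat \<Rightarrow> nat) \<Rightarrow> bool" where
  "indec k \<pi> \<longleftrightarrow> (\<forall>i. 1 \<le> i \<and> i < k \<longrightarrow> (\<exists>s\<in>{1..i}. \<exists>t\<in>{Suc i..k}. \<pi> t < \<pi> s))"

text \<open>The direct sum. Only the first length is an argument, because in this encoding a
  permutation is the identity beyond its own length.\<close>

definition dsum :: "nat \<Rightarrow> (nat \<Rightarrow> nat) \<Rightarrow> (nat \<Rightarrow> nat) \<Rightarrow> nat \<Rightarrow> nat" where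
  "dsum m \<sigma> \<tau> x = (if x \<le> m then \<sigma> x else \<tau> (x - m) + m)"

definition avoiders :: "nat \<Rightarrow> (nat \<Rightarrow> nat) set \<Rightarrow> nat \<Rightarrow> (nat \<Rightarrow> nat) set" where
  "avoiders k U n = {\<sigma>. \<sigma> permutes {1..n} \<and> (\<forall>\<pi>\<in>U. \<not> contains_perm n \<sigma> k \<pi>)}"

lemma finite_avoiders: "finite (avoiders k U n)"
  unfolding avoiders_def by (rule finite_subset[OF _ finite_permutations[of "{1..n}"]]) auto

lemma dsum_permutes:
  assumes \<sigma>: "\<sigma> permutes {1..m}" and \<tau>: "\<tau> permutes {1..n}"
  shows "dsum m \<sigma> \<tau> permutes {1..m + n}"
proof (rule bij_imp_permutes)
  have s: "\<sigma> x \<in> {1..m} \<longleftrightarrow> x \<in> {1..m}" "\<tau> x \<in> {1..n} \<longleftrightarrow> x \<in> {1..n}" for x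
    using permutes_in_image[OF \<sigma>] permutes_in_image[OF \<tau>] by auto
  have "inj_on (dsum m \<sigma> \<tau>) {1..m + n}"
  proof (rule inj_onI)
    fix x y assume x: "x \<in> {1..m + n}" "y \<in> {1..m + n}" "dsum m \<sigma> \<tau> x = dsum m \<sigma> \<tau> y"
    have big: "dsum m \<sigma> \<tau> z > m" if "z \<in> {1..m + n}" "z > m" for z
      using s(2)[of "z - m"] that by (auto simp: dsum_def)
    have small: "dsum m \<sigma> \<tau> z \<le> m" if "z \<in> {1..m + n}" "z \<le> m" for z
      using s(1)[of z] that by (auto simp: dsum_def)
    have xy: "x \<le> m \<longleftrightarrow> y \<le> m"
      using big[of x] big[of y] small[of x] small[of y] x by (metis not_less)
    show "x = y"
    proof (cases "x \<le> m")
      case True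
      then have "\<sigma> x = \<sigma> y" using x(3) xy by (simp add: dsum_def)
      then show ?thesis using permutes_inj[OF \<sigma>] by (meson injD)
    next
      case False
      then have "\<tau> (x - m) = \<tau> (y - m)" using x(3) xy by (simp add: dsum_def)
      then have "x - m = y - m" using permutes_inj[OF \<tau>] by (meson injD)
      then show ?thesis using False xy by auto
    qed
  qed
  moreover have "dsum m \<sigma> \<tau> ` {1..m + n} \<subseteq> {1..m + n}"
  proof
    fix y assume "y \<in> dsum m \<sigma> \<tau> ` {1..m + n}"
    then obtain x where x: "x \<in> {1..m + n}" "y = dsum m \<sigma> \<tau> x" by blast
    show "y \<in> {1..m + n}"
    proof (cases "x \<le> m")
      case True then show ?thesis using x s(1)[of x] by (auto simp: dsum_def)
    next
      case False then show ?thesis using x s(2)[of "x - m"] by (auto simp: dsum_def)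
    qed
  qed
  ultimately show "bij_betw (dsum m \<sigma> \<tau>) {1..m + n} {1..m + n}"
    by (simp add: bij_betw_def endo_inj_surj)
next
  fix x assume "x \<notin> {1..m + n}"
  then show "dsum m \<sigma> \<tau> x = x"
  proof (cases "x \<le> m")
    case True
    then show ?thesis using \<open>x \<notin> {1..m + n}\<close> permutes_not_in[OF \<sigma>, of x] by (auto simp: dsum_def)
  next
    case False
    then have "x - m \<notin> {1..n}" using \<open>x \<notin> {1..m + n}\<close> by auto
    then show ?thesis using False permutes_not_in[OF \<tau>] by (auto simp: dsum_def)
  qed
qed

lemma dsum_inject:
  assumes "\<sigma> permutes {1..m}" "\<tau> permutes {1..n}" "\<sigma>' permutes {1..m}" "\<tau>' permutes {1..n}"
    and eq: "dsum m \<sigma> \<tau> = dsum m \<sigma>' \<tau>'"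
  shows "\<sigma> = \<sigma>' \<and> \<tau> = \<tau>'"
proof (intro conjI ext)
  fix x
  show "\<sigma> x = \<sigma>' x"
  proof (cases "x \<le> m")
    case True then show ?thesis using fun_cong[OF eq, of x] by (simp add: dsum_def)
  next
    case False then show ?thesis using assms by (simp add: permutes_not_in)
  qed
  show "\<tau> x = \<tau>' x"
  proof (cases "x = 0")
    case True then show ?thesis using assms by (simp add: permutes_not_in)
  next
    case False then show ?thesis using fun_cong[OF eq, of "x + m"] by (simp add: dsum_def)
  qed
qed

text \<open>An occurrence inside one summand is an occurrence there. One meeting both summands would
  split the pattern into a prefix with smaller values and a suffix with larger ones, which
  indecomposability forbids.\<close>

lemma dsum_contains_indec:
  assumes c: "contains_perm (m + n) (dsum m \<sigma> \<tau>) k \<pi>" and \<pi>: "indec k \<pi>"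
    and \<sigma>: "\<sigma> permutes {1..m}" and \<tau>: "\<tau> permutes {1..n}"
  shows "contains_perm m \<sigma> k \<pi> \<or> contains_perm n \<tau> k \<pi>"
proof -
  from c obtain x where x: "strict_mono_on {1..k} x" "x ` {1..k} \<subseteq> {1..m + n}"
    "\<And>i j. i\<in>{1..k} \<Longrightarrow> j\<in>{1..k} \<Longrightarrow> dsum m \<sigma> \<tau> (x i) < dsum m \<sigma> \<tau> (x j) \<longleftrightarrow> \<pi> i < \<pi> j"
    unfolding contains_perm_def by blast
  have mono: "x i \<le> x j" if "i \<in> {1..k}" "j \<in> {1..k}" "i \<le> j" for i j
    using x(1) that strict_mono_on_leD by blast
  consider (a) "\<forall>t\<in>{1..k}. x t \<le> m" | (b) "\<forall>t\<in>{1..k}. x t > m"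
    | (c) "\<exists>t\<in>{1..k}. x t > m" "\<exists>t\<in>{1..k}. x t \<le> m" using not_less by blast
  then show ?thesis
  proof cases
    case a
    have "contains_perm m \<sigma> k \<pi>"
      unfolding contains_perm_def
    proof (intro exI[of _ x] conjI ballI)
      show "x ` {1..k} \<subseteq> {1..m}" using x(2) a by fastforce
      fix i j assume ij: "i \<in> {1..k}" "j \<in> {1..k}"
      then have "x i \<le> m" "x j \<le> m" using a by blast+
      then show "(\<sigma> (x i) < \<sigma> (x j)) = (\<pi> i < \<pi> j)"
        using x(3)[OF ij] by (auto simp: dsum_def)
    qed (rule x(1))
    then show ?thesis ..
  next
    case b
    have "contains_perm n \<tau> k \<pi>"
      unfolding contains_perm_def
    proof (intro exI[of _ "\<lambda>t. x t - m"] conjI ballI)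
      show "strict_mono_on {1..k} (\<lambda>t. x t - m)"
      proof (rule strict_mono_onI)
        fix r s assume "r \<in> {1..k}" "s \<in> {1..k}" "r < s"
        then show "x r - m < x s - m" using strict_mono_onD[OF x(1), of r s] b by (intro diff_less_mono less_imp_le) auto
      qed
      show "(\<lambda>t. x t - m) ` {1..k} \<subseteq> {1..n}" using x(2) b by fastforce
      fix i j assume ij: "i \<in> {1..k}" "j \<in> {1..k}"
      then have "m < x i" "m < x j" using b by blast+
      then show "(\<tau> (x i - m) < \<tau> (x j - m)) = (\<pi> i < \<pi> j)"
        using x(3)[OF ij] by (auto simp: dsum_def)
    qed
    then show ?thesis ..
  next
    case c
    \<comment> \<open>\<open>q\<close> is the first pattern position placed in the second summand.
      Indecomposability at the cut \<open>q - 1\<close> gives an inversion across the cut, whereas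
      \<open>dsum\<close> has none between its summands.\<close>
    define q where "q = (LEAST t. t \<in> {1..k} \<and> x t > m)"
    have q: "q \<in> {1..k} \<and> x q > m" unfolding q_def using c(1) by (metis (mono_tags, lifting) LeastI)
    have ql: "x t \<le> m" if "t \<in> {1..k}" "t < q" for t
      using not_less_Least[of t "\<lambda>t. t \<in> {1..k} \<and> x t > m"] that unfolding q_def by auto
    obtain t where t: "t \<in> {1..k}" "x t \<le> m" using c(2) by blast
    have "q \<noteq> 1" using mono[of q t] t q by auto
    then have i: "1 \<le> q - 1 \<and> q - 1 < k" using q by auto
    then obtain s t where st: "s \<in> {1..q - 1}" "t \<in> {Suc (q - 1)..k}" "\<pi> t < \<pi> s"
      using \<pi> unfolding indec_def by blast
    have s: "s \<in> {1..k}" "s < q" "t \<in> {1..k}" "q \<le> t" using st q by auto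
    have "x s \<in> {1..m + n}" "x t \<in> {1..m + n}" using s(1,3) x(2) by blast+
    then have xs: "x s \<le> m" "1 \<le> x s" "x t \<le> m + n" using ql s by auto
    have "m < x t" using mono[of q t] s q by auto
    then have "m < dsum m \<sigma> \<tau> (x t)" "dsum m \<sigma> \<tau> (x s) \<le> m"
      using permutes_in_image[OF \<tau>, of "x t - m"] permutes_in_image[OF \<sigma>, of "x s"] xs
      by (auto simp: dsum_def)
    then have "\<not> \<pi> t < \<pi> s" using x(3)[of t s] s by auto
    then show ?thesis using st by blast
  qed
qed

text \<open>Direct sums inject pairs of avoiders into the avoiders of the summed length. After
  taking logarithms this is the superadditivity required by Fekete's lemma.\<close>

lemma num_avoiders_supermult:
  assumes "\<And>\<pi>. \<pi> \<in> U \<Longrightarrow> indec k \<pi>"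
  shows "num_avoiders k U m * num_avoiders k U n \<le> num_avoiders k U (m + n)"
proof -
  have "card (avoiders k U m \<times> avoiders k U n) \<le> card (avoiders k U (m + n))"
  proof (rule card_inj_on_le[of "\<lambda>(\<sigma>, \<tau>). dsum m \<sigma> \<tau>"])
    show "inj_on (\<lambda>(\<sigma>, \<tau>). dsum m \<sigma> \<tau>) (avoiders k U m \<times> avoiders k U n)"
    proof (rule inj_onI, clarify)
      fix a b a' b' assume "a \<in> avoiders k U m" "b \<in> avoiders k U n" "a' \<in> avoiders k U m"
        "b' \<in> avoiders k U n" "dsum m a b = dsum m a' b'"
      then show "a = a' \<and> b = b'" unfolding avoiders_def by (intro dsum_inject) auto
    qed
    show "(\<lambda>(\<sigma>, \<tau>). dsum m \<sigma> \<tau>) ` (avoiders k U m \<times> avoiders k U n) \<subseteq> avoiders k U (m + n)"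
    proof clarify
      fix a b assume "a \<in> avoiders k U m" "b \<in> avoiders k U n"
      then have a: "a permutes {1..m}" "b permutes {1..n}"
        "\<And>\<pi>. \<pi> \<in> U \<Longrightarrow> \<not> contains_perm m a k \<pi>" "\<And>\<pi>. \<pi> \<in> U \<Longrightarrow> \<not> contains_perm n b k \<pi>"
        unfolding avoiders_def by auto
      show "dsum m a b \<in> avoiders k U (m + n)"
        unfolding avoiders_def using dsum_permutes[OF a(1,2)] dsum_contains_indec[OF _ assms a(1,2)] a(3,4)
        by blast
    qed
  qed (rule finite_avoiders)
  then show ?thesis unfolding num_avoiders_def avoiders_def[symmetric] by (simp add: card_cartesian_product)
qed

section \<open>Positivity and the exponential upper bound for the number of avoiders\<close>

lemma not_contains_perm_shorter:
  assumes "n < k"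
  shows "\<not> contains_perm n \<sigma> k \<pi>"
proof
  assume "contains_perm n \<sigma> k \<pi>"
  then show False
    unfolding contains_perm_def
  proof (elim exE conjE)
    fix x :: "nat \<Rightarrow> nat"
    assume "strict_mono_on {1..k} x" "x ` {1..k} \<subseteq> {1..n}"
    then have "card {1..k} \<le> card {1..n}"
      by (intro card_inj_on_le[of x] strict_mono_on_imp_inj_on) auto
    then show False using assms by simp
  qed
qed

lemma num_avoiders_pos_short:
  assumes "n < k"
  shows "num_avoiders k U n \<ge> 1"
proof -
  have "id \<in> avoiders k U n"
    using not_contains_perm_shorter[OF assms] unfolding avoiders_def by (simp add: permutes_id)
  then have "card (avoiders k U n) > 0" using finite_avoiders card_gt_0_iff by blast
  then show ?thesis unfolding num_avoiders_def avoiders_def by simp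
qed

text \<open>Direct sums of copies of the one-point permutation, which is too short to contain a
  pattern of length \<open>k \<ge> 2\<close>. Positivity makes the logarithms nonnegative and
  permits padding to larger lengths.\<close>

lemma num_avoiders_pos:
  assumes "\<And>\<pi>. \<pi> \<in> U \<Longrightarrow> indec k \<pi>" "k \<ge> 2"
  shows "num_avoiders k U n \<ge> 1"
proof (induction n)
  case 0
  show ?case by (rule num_avoiders_pos_short) (use assms(2) in simp)
next
  case (Suc n)
  have "1 * 1 \<le> num_avoiders k U n * num_avoiders k U 1"
    using assms(2) by (intro mult_le_mono Suc num_avoiders_pos_short) simp
  also have "\<dots> \<le> num_avoiders k U (n + 1)" by (rule num_avoiders_supermult) (rule assms(1))
  finally show ?case by simp
qed

text \<open>An avoider of \<open>\<pi>\<close> has no grid of size \<open>k\<close>, so for lengths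
  \<open>2 ^ j\<close> the count of grid-free sets applies to its point set. Other lengths are
  padded to the next power of 2, at most \<open>2 * n\<close>, which doubles the constant.\<close>

lemma num_avoiders_upper:
  assumes ind: "\<And>\<pi>. \<pi> \<in> U \<Longrightarrow> indec k \<pi>" "k \<ge> 2"
    and U: "\<pi> \<in> U" "\<pi> permutes {1..k}"
  obtains C where "\<And>n. num_avoiders k U n \<le> 2 ^ (C * n)"
proof -
  obtain C where C: "\<And>j. card {P. P \<subseteq> {..<2 ^ j} \<times> {..<2 ^ j} \<and> \<not> grid k P} \<le> 2 ^ (C * 2 ^ j)"
    using card_grid_free_sets[of k] ind(2) by auto
  have pow: "num_avoiders k U (2 ^ j) \<le> 2 ^ (C * 2 ^ j)" for j
  proof -
    define N :: nat where "N = 2 ^ j"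
    define \<Phi> :: "(nat \<Rightarrow> nat) \<Rightarrow> (nat \<times> nat) set"
      where "\<Phi> \<sigma> = map_prod (\<lambda>x. x - 1) (\<lambda>x. x - 1) ` perm_points N \<sigma>" for \<sigma>
    have mono1: "mono (\<lambda>x::nat. x - 1)" by (auto simp: mono_def)
    have "card (avoiders k U N) \<le> card {P. P \<subseteq> {..<N} \<times> {..<N} \<and> \<not> grid k P}"
    proof (rule card_inj_on_le[of \<Phi>])
      show "finite {P. P \<subseteq> {..<N} \<times> {..<N} \<and> \<not> grid k P}"
        by (rule finite_subset[of _ "Pow ({..<N} \<times> {..<N})"]) auto
      show "\<Phi> ` avoiders k U N \<subseteq> {P. P \<subseteq> {..<N} \<times> {..<N} \<and> \<not> grid k P}"
      proof safe
        fix \<sigma> assume \<sigma>: "\<sigma> \<in> avoiders k U N"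
        then have p: "\<sigma> permutes {1..N}" unfolding avoiders_def by blast
        {
          fix a b assume "(a, b) \<in> \<Phi> \<sigma>"
          then obtain x where "x \<in> {1..N}" "a = x - 1" "b = \<sigma> x - 1"
            unfolding \<Phi>_def perm_points_def by auto
          moreover then have "\<sigma> x \<in> {1..N}" using permutes_in_image[OF p] by blast
          ultimately show "a < N" "b < N" by auto
        }
        {
          assume "grid k (\<Phi> \<sigma>)"
          then have "grid k (perm_points N \<sigma>)" unfolding \<Phi>_def using grid_mono_image[OF mono1 mono1] by blast
          then have "contains_perm N \<sigma> k \<pi>" by (rule contains_perm_of_grid[OF _ U(2)])
          then show False using \<sigma> U(1) unfolding avoiders_def by blast
        }
      qed
      show "inj_on \<Phi> (avoiders k U N)"
      proof (rule inj_onI)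
        fix \<sigma> \<tau> assume a: "\<sigma> \<in> avoiders k U N" "\<tau> \<in> avoiders k U N" "\<Phi> \<sigma> = \<Phi> \<tau>"
        then have p: "\<sigma> permutes {1..N}" "\<tau> permutes {1..N}" unfolding avoiders_def by blast+
        show "\<sigma> = \<tau>"
        proof
          fix x
          show "\<sigma> x = \<tau> x"
          proof (cases "x \<in> {1..N}")
            case True
            then have "(x - 1, \<sigma> x - 1) \<in> \<Phi> \<tau>" unfolding a(3)[symmetric]
              unfolding \<Phi>_def perm_points_def by force
            then obtain y where y: "y \<in> {1..N}" "x - 1 = y - 1" "\<sigma> x - 1 = \<tau> y - 1"
              unfolding \<Phi>_def perm_points_def by auto
            then have "x = y" using True by auto
            moreover have "\<sigma> x \<in> {1..N}" "\<tau> x \<in> {1..N}"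
              using True permutes_in_image[OF p(1)] permutes_in_image[OF p(2)] by blast+
            ultimately show ?thesis using y(3) by auto
          next
            case False then show ?thesis using p by (simp add: permutes_not_in)
          qed
        qed
      qed
    qed
    then show ?thesis using C[of j] unfolding num_avoiders_def avoiders_def[symmetric] N_def by linarith
  qed
  have "num_avoiders k U n \<le> 2 ^ ((2 * C) * n)" if n: "n > 0" for n
  proof -
    define j where "j = (LEAST j. n \<le> 2 ^ j)"
    have ex: "n \<le> 2 ^ n" using less_exp[of n] by linarith
    then have nj: "n \<le> 2 ^ j" unfolding j_def by (rule LeastI)
    have "2 ^ j \<le> 2 * n"
    proof (cases j)
      case 0 then show ?thesis using n by simp
    next
      case (Suc i)
      then have "\<not> n \<le> 2 ^ i" using not_less_Least[of i "\<lambda>j. n \<le> 2 ^ j"] unfolding j_def by auto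
      then show ?thesis using Suc by simp
    qed
    have "num_avoiders k U n * 1 \<le> num_avoiders k U n * num_avoiders k U (2 ^ j - n)"
      by (intro mult_le_mono2 num_avoiders_pos ind)
    also have "\<dots> \<le> num_avoiders k U (n + (2 ^ j - n))" by (intro num_avoiders_supermult ind)
    also have "\<dots> = num_avoiders k U (2 ^ j)" using nj by simp
    also have "\<dots> \<le> 2 ^ (C * 2 ^ j)" by (rule pow)
    also have "\<dots> \<le> 2 ^ (C * (2 * n))" using \<open>2 ^ j \<le> 2 * n\<close> by (intro power_increasing mult_le_mono2) auto
    finally show ?thesis by (simp add: algebra_simps)
  qed
  moreover have "num_avoiders k U 0 \<le> 2 ^ ((2 * C) * 0)"
  proof -
    have "avoiders k U 0 \<subseteq> {id}" unfolding avoiders_def by auto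
    then show ?thesis unfolding num_avoiders_def avoiders_def[symmetric]
      using card_mono[of "{id}" "avoiders k U 0"] by simp
  qed
  ultimately show ?thesis using that[of "2 * C"] by (metis gr0I)
qed

section \<open>Fekete's lemma and the limit\<close>

text \<open>The limit is the supremum of the quotients: dividing \<open>n\<close> by
  \<open>m\<close> with remainder shows that a quotient near the supremum at \<open>m\<close> is
  nearly attained at all large \<open>n\<close>. That the limit dominates every quotient later turns
  a count at one length into a bound on the growth rate.\<close>

lemma fekete:
  fixes u :: "nat \<Rightarrow> real"
  assumes super: "\<And>m n. u m + u n \<le> u (m + n)" and bd: "\<And>n. u n \<le> C * real n" and nn: "\<And>n. u n \<ge> 0"
  obtains L where "(\<lambda>n. u n / real n) \<longlonglongrightarrow> L" "\<And>n. n > 0 \<Longrightarrow> u n / real n \<le> L"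
proof -
  define A where "A = (\<lambda>n. u n / real n) ` {0<..}"
  have bdd: "bdd_above A"
    unfolding A_def using bd by (intro bdd_aboveI[of _ C]) (auto simp: field_simps)
  have ne: "A \<noteq> {}" unfolding A_def by auto
  have le: "u n / real n \<le> Sup A" if "n > 0" for n
    by (rule cSup_upper[OF _ bdd]) (use that in \<open>auto simp: A_def\<close>)
  have mult: "real q * u m \<le> u (q * m)" for q m
  proof (induction q)
    case 0 then show ?case using nn by simp
  next
    case (Suc q)
    then show ?case using super[of m "q * m"] by (simp add: algebra_simps)
  qed
  have "(\<lambda>n. u n / real n) \<longlonglongrightarrow> Sup A"
  proof (rule LIMSEQ_I)
    fix e :: real assume e: "e > 0"
    then obtain a where a: "a \<in> A" "Sup A - e / 2 < a"
      using less_cSup_iff[OF ne bdd, of "Sup A - e / 2"] by auto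
    then obtain m where m: "m > 0" "a = u m / real m" unfolding A_def by auto
    \<comment> \<open>Beyond \<open>N\<close> the incomplete last block costs only
      \<open>u m / real n < e / 2\<close>.\<close>
    define N where "N = nat \<lceil>2 * u m / e\<rceil> + 1"
    have "norm (u n / real n - Sup A) < e" if "n \<ge> N" for n
    proof -
      have n0: "n > 0" using that unfolding N_def by simp
      have nN: "real n > 2 * u m / e" using that unfolding N_def by linarith
      have "real n = real (n div m) * real m + real (n mod m)"
        by (metis div_mult_mod_eq of_nat_add of_nat_mult)
      then have dm: "real n \<le> (real (n div m) + 1) * real m"
        using mod_less_divisor[OF m(1), of n] by (simp add: algebra_simps)
      have "real n * a \<le> (real (n div m) + 1) * real m * a"
        using dm m nn[of m] by (intro mult_right_mono) auto
      also have "\<dots> = (real (n div m)) * u m + u m" using m by (simp add: algebra_simps)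
      also have "\<dots> \<le> u (n div m * m) + u m" using mult[of "n div m" m] by simp
      also have "\<dots> \<le> u n + u m"
        using super[of "n div m * m" "n mod m"] nn[of "n mod m"] by simp
      finally have "(real n * a - u m) / real n \<le> u n / real n"
        by (intro divide_right_mono) auto
      then have "a - u m / real n \<le> u n / real n" using n0 by (simp add: diff_divide_distrib)
      moreover have "u m / real n < e / 2" using nN n0 e by (simp add: field_simps)
      ultimately show ?thesis using le[OF n0] a(2) by simp
    qed
    then show "\<exists>N. \<forall>n\<ge>N. norm (u n / real n - Sup A) < e" by blast
  qed
  then show ?thesis using that le by blast
qed

theorem growth_limit:
  assumes ind: "\<And>\<pi>. \<pi> \<in> U \<Longrightarrow> indec k \<pi>" "k \<ge> 2"
    and U: "\<pi> \<in> U" "\<pi> permutes {1..k}"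
  obtains L where "(\<lambda>n. real (num_avoiders k U n) powr (1 / real n)) \<longlonglongrightarrow> L"
    "\<And>n. n > 0 \<Longrightarrow> real (num_avoiders k U n) powr (1 / real n) \<le> L"
proof -
  obtain C where C: "\<And>n. num_avoiders k U n \<le> 2 ^ (C * n)"
    using num_avoiders_upper[OF ind U] by blast
  define u where "u n = ln (real (num_avoiders k U n))" for n
  have pos: "real (num_avoiders k U n) \<ge> 1" for n using num_avoiders_pos[where n = n, OF ind] by simp
  have "u m + u n \<le> u (m + n)" for m n
  proof -
    have "u m + u n = ln (real (num_avoiders k U m * num_avoiders k U n))"
      unfolding u_def of_nat_mult using pos[of m] pos[of n] by (subst ln_mult) auto
    also have "\<dots> \<le> u (m + n)"
      unfolding u_def
    proof (rule ln_mono)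
      show "real (num_avoiders k U m * num_avoiders k U n) \<le> real (num_avoiders k U (m + n))"
        unfolding of_nat_le_iff by (intro num_avoiders_supermult ind)
      show "real (num_avoiders k U m * num_avoiders k U n) > 0"
        unfolding of_nat_mult using pos[of m] pos[of n] by (intro mult_pos_pos) auto
    qed
    finally show ?thesis .
  qed
  moreover have "u n \<le> (real C * ln 2) * real n" for n
  proof -
    have "real (num_avoiders k U n) \<le> 2 ^ (C * n)" using C[of n] by (metis of_nat_le_iff of_nat_numeral of_nat_power)
    then have "u n \<le> ln (2 ^ (C * n))" unfolding u_def using pos[of n] by (subst ln_le_cancel_iff) auto
    also have "\<dots> = (real C * ln 2) * real n" by (simp add: ln_realpow)
    finally show ?thesis .
  qed
  moreover have "u n \<ge> 0" for n unfolding u_def using pos[of n] by simp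
  ultimately obtain L where L: "(\<lambda>n. u n / real n) \<longlonglongrightarrow> L" "\<And>n. n > 0 \<Longrightarrow> u n / real n \<le> L"
    using fekete by metis
  \<comment> \<open>At \<open>n = 0\<close> both sides are 1, since division by zero gives
    0.\<close>
  have eq: "real (num_avoiders k U n) powr (1 / real n) = exp (u n / real n)" for n
    unfolding u_def powr_def using pos[of n] by auto
  show ?thesis
    by (rule that[of "exp L"]) (use L in \<open>auto simp: eq intro: tendsto_exp\<close>)
qed

section \<open>A dense matrix without large grids\<close>

text \<open>The pair \<open>(s, q)\<close> stands for the dyadic interval of all \<open>x\<close>
  with \<open>x div 2 ^ s = q\<close>. Allowing every \<open>q < 2 ^ r\<close> at each level adds
  intervals beyond \<open>{..<2 ^ r}\<close>, but makes the family a product with at most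
  \<open>4 ^ r\<close> members.\<close>

definition dyadics :: "nat \<Rightarrow> (nat \<times> nat) set" where
  "dyadics r = {..r} \<times> {..<2 ^ r}"

definition dyadics_of :: "nat \<Rightarrow> nat \<Rightarrow> (nat \<times> nat) set" where
  "dyadics_of r x = (\<lambda>s. (s, x div 2 ^ s)) ` {..r}"

lemma dyadics_of_subset: "x < 2 ^ r \<Longrightarrow> dyadics_of r x \<subseteq> dyadics r"
  unfolding dyadics_of_def dyadics_def by (auto intro: le_less_trans[OF div_le_dividend])

lemma card_dyadics_of: "card (dyadics_of r x) = r + 1"
  unfolding dyadics_of_def by (subst card_image) (auto simp: inj_on_def)

lemma finite_dyadics: "finite (dyadics r)" unfolding dyadics_def by simp

lemma card_dyadics_le: "card (dyadics r) \<le> 4 ^ r"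
proof -
  have "r + 1 \<le> 2 ^ r" using less_exp[of r] by linarith
  then have "(r + 1) * 2 ^ r \<le> 2 ^ r * 2 ^ r" by (rule mult_le_mono1)
  also have "\<dots> = 4 ^ r" by (simp flip: power_mult_distrib)
  finally show ?thesis unfolding dyadics_def by (simp add: card_cartesian_product)
qed

text \<open>The interval \<open>h i\<close> is the smallest dyadic interval containing \<open>I i\<close>. If it has more than one
  point, then \<open>I i\<close> meets both of its halves, which is impossible for two separated sets.\<close>

lemma separated_sets_dyadics:
  fixes I :: "nat \<Rightarrow> nat set"
  assumes ne: "\<And>i. i < l \<Longrightarrow> I i \<noteq> {}" and sub: "\<And>i x. i < l \<Longrightarrow> x \<in> I i \<Longrightarrow> x < 2 ^ r"
    and sep: "\<And>i i' x y. i < i' \<Longrightarrow> i' < l \<Longrightarrow> x \<in> I i \<Longrightarrow> y \<in> I i' \<Longrightarrow> x < y"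
  obtains h where "inj_on h {..<l}" "\<And>i x. i < l \<Longrightarrow> x \<in> I i \<Longrightarrow> h i \<in> dyadics_of r x"
proof -
  \<comment> \<open>\<open>flat i s\<close> says that \<open>I i\<close> lies in one dyadic interval
    of level \<open>s\<close>; a least such level exists because level \<open>r\<close> has one
    interval covering all points below \<open>2 ^ r\<close>.\<close>
  define flat where "flat i s \<longleftrightarrow> (\<forall>x\<in>I i. \<forall>y\<in>I i. x div 2 ^ s = y div 2 ^ s)" for i s
  define lev where "lev i = (LEAST s. flat i s)" for i
  have fr: "flat i r" if "i < l" for i using sub[OF that] unfolding flat_def by simp
  have fl: "flat i (lev i)" if "i < l" for i unfolding lev_def using fr[OF that] by (rule LeastI)
  have levr: "lev i \<le> r" if "i < l" for i unfolding lev_def using fr[OF that] by (rule Least_le)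
  have notfl: "\<not> flat i s" if "s < lev i" for i s using that unfolding lev_def by (rule not_less_Least)
  define h where "h i = (lev i, (SOME x. x \<in> I i) div 2 ^ lev i)" for i
  have h: "h i = (lev i, x div 2 ^ lev i)" if "i < l" "x \<in> I i" for i x
  proof -
    have "(SOME x. x \<in> I i) \<in> I i" using that(2) by (rule someI)
    then have "(SOME x. x \<in> I i) div 2 ^ lev i = x div 2 ^ lev i"
      using fl[OF that(1)] that(2) unfolding flat_def by blast
    then show ?thesis unfolding h_def by simp
  qed
  have neq: "h i \<noteq> h i'" if i: "i < i'" "i' < l" for i i'
  proof
    assume eq: "h i = h i'"
    have il: "i < l" using i by simp
    obtain x0 where x0: "x0 \<in> I i" using ne[OF il] by blast
    obtain y0 where y0: "y0 \<in> I i'" using ne[OF i(2)] by blast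
    define d where "d = x0 div 2 ^ lev i"
    have le: "lev i' = lev i" using eq unfolding h_def by simp
    have dx: "x div 2 ^ lev i = d" if "x \<in> I i" for x using h[OF il that] h[OF il x0] unfolding d_def by simp
    have dy: "y div 2 ^ lev i = d" if "y \<in> I i'" for y
      using h[OF i(2) that] h[OF il x0] eq le unfolding d_def by simp
    show False
    proof (cases "lev i")
      case 0
      then show False using dx[OF x0] dy[OF y0] sep[OF i x0 y0] by simp
    next
      case (Suc s)
      have half: "z div 2 ^ s \<in> {2 * d, 2 * d + 1}" if "z div 2 ^ lev i = d" for z
      proof -
        have "z div 2 ^ s div 2 = d" using that Suc div_mult2_eq[of z "2 ^ s" 2] by (simp add: mult.commute)
        then show ?thesis by auto
      qed
      have "\<exists>x\<in>I i. x div 2 ^ s = 2 * d + 1"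
      proof (rule ccontr)
        assume "\<not> ?thesis"
        then have "\<forall>x\<in>I i. x div 2 ^ s = 2 * d" using half dx by blast
        then have "flat i s" unfolding flat_def by simp
        then show False using notfl[of s i] Suc by simp
      qed
      then obtain x where x: "x \<in> I i" "x div 2 ^ s = 2 * d + 1" by blast
      have "\<exists>y\<in>I i'. y div 2 ^ s = 2 * d"
      proof (rule ccontr)
        assume "\<not> ?thesis"
        then have "\<forall>x\<in>I i'. x div 2 ^ s = 2 * d + 1" using half dy by blast
        then have "flat i' s" unfolding flat_def by simp
        then show False using notfl[of s i'] Suc le by simp
      qed
      then obtain y where y: "y \<in> I i'" "y div 2 ^ s = 2 * d" by blast
      have "x div 2 ^ s \<le> y div 2 ^ s" using sep[OF i x(1) y(1)] by (intro div_le_mono) simp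
      then show False using x y by simp
    qed
  qed
  show ?thesis
  proof (rule that[of h])
    show "inj_on h {..<l}"
    proof (rule inj_onI)
      fix i j assume "i \<in> {..<l}" "j \<in> {..<l}" "h i = h j"
      then show "i = j" using neq[of i j] neq[of j i] by (cases i j rule: linorder_cases) auto
    qed
    fix i x assume "i < l" "x \<in> I i"
    then show "h i \<in> dyadics_of r x" using h levr unfolding dyadics_of_def by auto
  qed
qed

text \<open>Colour 0 marks a discarded product of intervals. With colours drawn uniformly from
  \<open>{..<Q}\<close> each product is discarded independently with probability
  \<open>1 / Q\<close>, so probabilities become counts of colourings.\<close>

definition dyadic_matrix :: "nat \<Rightarrow> ((nat \<times> nat) \<times> (nat \<times> nat) \<Rightarrow> nat) \<Rightarrow> (nat \<times> nat) set" where
  "dyadic_matrix r \<chi> = {(a, b). a < 2 ^ r \<and> b < 2 ^ r \<and> (\<forall>\<kappa>\<in>dyadics_of r a \<times> dyadics_of r b. \<chi> \<kappa> \<noteq> 0)}"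

text \<open>The interval \<open>h i\<close> contains all row coordinates of grid row
  \<open>i\<close>, and \<open>g j\<close> all column coordinates of grid column \<open>j\<close>.
  Their product thus contains the surviving cell \<open>p i j\<close> and was kept.\<close>

lemma grid_dyadic_matrix:
  assumes "grid l (dyadic_matrix r \<chi>)"
  shows "\<exists>R C. R \<subseteq> dyadics r \<and> card R = l \<and> C \<subseteq> dyadics r \<and> card C = l \<and> (\<forall>\<kappa>\<in>R \<times> C. \<chi> \<kappa> \<noteq> 0)"
\<comment> \<open>A positive \<open>l\<close> makes the coordinate sets nonempty, as the choice of
  dyadic intervals requires.\<close>
proof (cases "l = 0")
  case True
  then show ?thesis by (intro exI[of _ "{}"]) auto
next
  case False
  from assms obtain p where "grid_at l (dyadic_matrix r \<chi>) p" unfolding grid_def by blast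
  note p = grid_atD[OF this]
  have cell: "fst (p i j) < 2 ^ r" "snd (p i j) < 2 ^ r"
    "\<forall>\<kappa>\<in>dyadics_of r (fst (p i j)) \<times> dyadics_of r (snd (p i j)). \<chi> \<kappa> \<noteq> 0" if "i < l" "j < l" for i j
    using p(1)[OF that] unfolding dyadic_matrix_def by auto
  obtain h where h: "inj_on h {..<l}"
    "\<And>i x. i < l \<Longrightarrow> x \<in> (\<lambda>j. fst (p i j)) ` {..<l} \<Longrightarrow> h i \<in> dyadics_of r x"
    by (rule separated_sets_dyadics[of l "\<lambda>i. (\<lambda>j. fst (p i j)) ` {..<l}" r])
      (use False cell p(2) in auto)
  obtain g where g: "inj_on g {..<l}"
    "\<And>j x. j < l \<Longrightarrow> x \<in> (\<lambda>i. snd (p i j)) ` {..<l} \<Longrightarrow> g j \<in> dyadics_of r x"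
    by (rule separated_sets_dyadics[of l "\<lambda>j. (\<lambda>i. snd (p i j)) ` {..<l}" r])
      (use False cell p(3) in auto)
  have hg: "h i \<in> dyadics_of r (fst (p i j))" "g j \<in> dyadics_of r (snd (p i j))" if "i < l" "j < l" for i j
    using h(2)[of i "fst (p i j)"] g(2)[of j "snd (p i j)"] that by auto
  show ?thesis
  proof (intro exI conjI)
    show "h ` {..<l} \<subseteq> dyadics r" "g ` {..<l} \<subseteq> dyadics r"
      using hg[of _ 0] hg[of 0] cell(1)[of _ 0] cell(2)[of 0] False dyadics_of_subset by fastforce+
    show "card (h ` {..<l}) = l" "card (g ` {..<l}) = l"
      using h(1) g(1) by (simp_all add: card_image)
    show "\<forall>\<kappa>\<in>h ` {..<l} \<times> g ` {..<l}. \<chi> \<kappa> \<noteq> 0"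
    proof
      fix \<kappa> assume "\<kappa> \<in> h ` {..<l} \<times> g ` {..<l}"
      then obtain i j where "i < l" "j < l" "\<kappa> = (h i, g j)" by auto
      then show "\<chi> \<kappa> \<noteq> 0" using cell(3)[of i j] hg[of i j] by blast
    qed
  qed
qed

section \<open>Counting colourings and the first-moment argument\<close>

text \<open>Independence in counting form: each point of \<open>T\<close> loses one of its
  \<open>Q\<close> colours, the other points lose none.\<close>

lemma card_nonzero_colourings:
  fixes V :: "'a set"
  assumes "finite V" "T \<subseteq> V" "Q > 0"
  shows "real (card {\<chi> \<in> V \<rightarrow>\<^sub>E {..<Q}. \<forall>\<kappa>\<in>T. \<chi> \<kappa> \<noteq> 0}) = real (Q ^ card V) * (1 - 1 / real Q) ^ card T"
proof -
  have eq: "{\<chi> \<in> V \<rightarrow>\<^sub>E {..<Q}. \<forall>\<kappa>\<in>T. \<chi> \<kappa> \<noteq> 0} = PiE V (\<lambda>\<kappa>. if \<kappa> \<in> T then {1..<Q} else {..<Q})"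
  proof (intro set_eqI iffI)
    fix \<chi> assume a: "\<chi> \<in> {\<chi> \<in> V \<rightarrow>\<^sub>E {..<Q}. \<forall>\<kappa>\<in>T. \<chi> \<kappa> \<noteq> 0}"
    show "\<chi> \<in> PiE V (\<lambda>\<kappa>. if \<kappa> \<in> T then {1..<Q} else {..<Q})"
    proof (rule PiE_I)
      fix x assume "x \<in> V"
      then have "\<chi> x \<in> {..<Q}" "x \<in> T \<Longrightarrow> \<chi> x \<noteq> 0" using a by (auto simp: PiE_def Pi_def)
      then show "\<chi> x \<in> (if x \<in> T then {1..<Q} else {..<Q})" by auto
    qed (use a in \<open>auto simp: PiE_def extensional_def\<close>)
  next
    fix \<chi> assume a: "\<chi> \<in> PiE V (\<lambda>\<kappa>. if \<kappa> \<in> T then {1..<Q} else {..<Q})"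
    then have b: "\<chi> x \<in> (if x \<in> T then {1..<Q} else {..<Q})" if "x \<in> V" for x
      using that by (rule PiE_mem)
    have "\<chi> x \<in> {..<Q}" if "x \<in> V" for x using b[OF that] by (auto split: if_splits)
    moreover have "\<chi> x \<noteq> 0" if "x \<in> T" for x using b[of x] that assms(2) by auto
    ultimately show "\<chi> \<in> {\<chi> \<in> V \<rightarrow>\<^sub>E {..<Q}. \<forall>\<kappa>\<in>T. \<chi> \<kappa> \<noteq> 0}"
      using a by (auto simp: PiE_def extensional_def)
  qed
  have fT: "finite T" using assms finite_subset by blast
  have "card (PiE V (\<lambda>\<kappa>. if \<kappa> \<in> T then {1..<Q} else {..<Q})) = (\<Prod>\<kappa>\<in>V. if \<kappa> \<in> T then Q - 1 else Q)"
    using assms(1) by (subst card_PiE) (auto intro!: prod.cong)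
  also have "\<dots> = (Q - 1) ^ card T * Q ^ card (V - T)"
    using assms by (subst prod.If_cases) (auto simp: Int_absorb1 Diff_eq)
  finally have c: "real (card (PiE V (\<lambda>\<kappa>. if \<kappa> \<in> T then {1..<Q} else {..<Q})))
      = (real Q - 1) ^ card T * real Q ^ card (V - T)"
    using assms(3) by (simp add: of_nat_diff)
  have cV: "card V = card T + card (V - T)"
    using assms card_Diff_subset[OF fT assms(2)] card_mono[OF assms(1,2)] by simp
  have "1 - 1 / real Q = (real Q - 1) / real Q" using assms(3) by (simp add: field_simps)
  then show ?thesis
    unfolding eq c cV using assms(3) by (simp add: power_add power_divide)
qed

text \<open>With \<open>q = 1 - 1 / real Q\<close> the mean number of cells is
  \<open>4 ^ r * q ^ (r + 1)\<^sup>2\<close>. If every grid-free matrix had less than a quarter of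
  it, then, since colourings with a grid contribute at most half of it, the mean would be at most
  three quarters of itself.\<close>

lemma ex_dense_dyadic_matrix:
  assumes Q: "Q > 1"
    and small: "real ((card (dyadics r) choose l)\<^sup>2) * (1 - 1 / real Q) ^ l\<^sup>2 \<le> (1 - 1 / real Q) ^ (r + 1)\<^sup>2 / 2"
  shows "\<exists>A. A \<subseteq> {..<2 ^ r} \<times> {..<2 ^ r} \<and> \<not> grid l A \<and>
    4 ^ r * (1 - 1 / real Q) ^ (r + 1)\<^sup>2 / 4 \<le> real (card A)"
proof (rule ccontr)
  assume none: "\<not> ?thesis"
  define q where "q = 1 - 1 / real Q"
  define V where "V = dyadics r \<times> dyadics r"
  define \<Omega> where "\<Omega> = V \<rightarrow>\<^sub>E {..<Q}"
  define cells :: "(nat \<times> nat) set" where "cells = {..<2 ^ r} \<times> {..<2 ^ r}"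
  define bad where "bad = {\<chi> \<in> \<Omega>. grid l (dyadic_matrix r \<chi>)}"
  define w where "w = real (Q ^ card V)"
  have w0: "w > 0" unfolding w_def using Q by simp
  have Q0: "Q > 0" using Q by simp
  have q0: "q > 0" unfolding q_def using Q by simp
  have fV: "finite V" unfolding V_def using finite_dyadics by simp
  have f\<Omega>: "finite \<Omega>" unfolding \<Omega>_def using fV by (intro finite_PiE) auto
  have card\<Omega>: "real (card \<Omega>) = w" unfolding \<Omega>_def w_def using fV by (simp add: card_PiE)
  have dm: "dyadic_matrix r \<chi> \<subseteq> cells" for \<chi> unfolding dyadic_matrix_def cells_def by auto
  have fc: "finite cells" "card cells = 4 ^ r" unfolding cells_def
    by (auto simp: card_cartesian_product simp flip: power_mult_distrib)
  have sparse: "real (card (dyadic_matrix r \<chi>)) < 4 ^ r * q ^ (r + 1)\<^sup>2 / 4" if "\<not> grid l (dyadic_matrix r \<chi>)" for \<chi>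
    using none that dm[of \<chi>] unfolding cells_def q_def by (metis not_less)
  define S where "S = {R. R \<subseteq> dyadics r \<and> card R = l}"
  have fS: "finite S" unfolding S_def using finite_dyadics by simp
  have cS: "card S = card (dyadics r) choose l" unfolding S_def using finite_dyadics by (rule n_subsets)
  define ev where "ev T = {\<chi> \<in> \<Omega>. \<forall>\<kappa>\<in>T. \<chi> \<kappa> \<noteq> 0}" for T
  have cev: "real (card (ev T)) = w * q ^ card T" if "T \<subseteq> V" for T
    unfolding ev_def \<Omega>_def w_def q_def using fV that Q0 by (rule card_nonzero_colourings)
  have fev: "finite (ev T)" for T unfolding ev_def using f\<Omega> by simp
  \<comment> \<open>Union bound over the pairs of families \<open>R\<close> and \<open>C\<close>;
    each event requires \<open>l\<^sup>2\<close> products to be kept.\<close>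
  have "bad \<subseteq> (\<Union>RC\<in>S \<times> S. ev (fst RC \<times> snd RC))"
  proof
    fix \<chi> assume "\<chi> \<in> bad"
    then have \<chi>: "\<chi> \<in> \<Omega>" "grid l (dyadic_matrix r \<chi>)" unfolding bad_def by auto
    from grid_dyadic_matrix[OF \<chi>(2)] obtain R C where "R \<in> S" "C \<in> S" "\<forall>\<kappa>\<in>R \<times> C. \<chi> \<kappa> \<noteq> 0"
      unfolding S_def by blast
    then show "\<chi> \<in> (\<Union>RC\<in>S \<times> S. ev (fst RC \<times> snd RC))"
      using \<chi>(1) unfolding ev_def by (intro UN_I[of "(R, C)"]) auto
  qed
  then have "card bad \<le> card (\<Union>RC\<in>S \<times> S. ev (fst RC \<times> snd RC))"
    using fS fev by (intro card_mono) auto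
  also have "\<dots> \<le> (\<Sum>RC\<in>S \<times> S. card (ev (fst RC \<times> snd RC)))"
    using fS by (intro card_UN_le) auto
  finally have "real (card bad) \<le> (\<Sum>RC\<in>S \<times> S. real (card (ev (fst RC \<times> snd RC))))"
    unfolding of_nat_sum[symmetric] of_nat_le_iff .
  also have "\<dots> = (\<Sum>RC\<in>S \<times> S. w * q ^ l\<^sup>2)"
  proof (rule sum.cong[OF refl])
    fix RC assume "RC \<in> S \<times> S"
    then have "fst RC \<times> snd RC \<subseteq> V" "card (fst RC \<times> snd RC) = l\<^sup>2"
      unfolding S_def V_def by (auto simp: card_cartesian_product power2_eq_square)
    then show "real (card (ev (fst RC \<times> snd RC))) = w * q ^ l\<^sup>2" using cev by simp
  qed
  also have "\<dots> = w * (real ((card (dyadics r) choose l)\<^sup>2) * q ^ l\<^sup>2)"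
    by (simp add: card_cartesian_product cS power2_eq_square)
  also have "\<dots> \<le> w * (q ^ (r + 1)\<^sup>2 / 2)"
    using small w0 unfolding q_def by (intro mult_left_mono) auto
  finally have bad_le: "real (card bad) \<le> w * q ^ (r + 1)\<^sup>2 / 2" by simp
  \<comment> \<open>Double counting: a cell survives exactly when its \<open>(r + 1)\<^sup>2\<close>
    products are all kept.\<close>
  have "(\<Sum>\<chi>\<in>\<Omega>. real (card (dyadic_matrix r \<chi>))) = (\<Sum>\<chi>\<in>\<Omega>. \<Sum>z\<in>cells. if z \<in> dyadic_matrix r \<chi> then 1 else 0)"
  proof (rule sum.cong[OF refl])
    fix \<chi> show "real (card (dyadic_matrix r \<chi>)) = (\<Sum>z\<in>cells. if z \<in> dyadic_matrix r \<chi> then 1 else 0)"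
      using fc dm[of \<chi>] by (simp add: sum.If_cases Int_absorb1)
  qed
  also have "\<dots> = (\<Sum>z\<in>cells. \<Sum>\<chi>\<in>\<Omega>. if z \<in> dyadic_matrix r \<chi> then 1 else 0)" by (rule sum.swap)
  also have "\<dots> = (\<Sum>z\<in>cells. w * q ^ (r + 1)\<^sup>2)"
  proof (rule sum.cong[OF refl])
    fix z assume z: "z \<in> cells"
    define T where "T = dyadics_of r (fst z) \<times> dyadics_of r (snd z)"
    have "T \<subseteq> V"
      unfolding T_def V_def using z by (intro Sigma_mono dyadics_of_subset) (auto simp: cells_def)
    moreover have "card T = (r + 1)\<^sup>2"
      unfolding T_def by (simp add: card_cartesian_product card_dyadics_of power2_eq_square)
    moreover have "{\<chi> \<in> \<Omega>. z \<in> dyadic_matrix r \<chi>} = ev T"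
      using z unfolding ev_def T_def dyadic_matrix_def cells_def by auto
    ultimately have "real (card {\<chi> \<in> \<Omega>. z \<in> dyadic_matrix r \<chi>}) = w * q ^ (r + 1)\<^sup>2"
      using cev by simp
    then show "(\<Sum>\<chi>\<in>\<Omega>. if z \<in> dyadic_matrix r \<chi> then 1 else 0) = w * q ^ (r + 1)\<^sup>2"
      using f\<Omega> by (simp add: sum.If_cases Int_def)
  qed
  also have "\<dots> = 4 ^ r * (w * q ^ (r + 1)\<^sup>2)" by (simp add: fc)
  finally have total: "(\<Sum>\<chi>\<in>\<Omega>. real (card (dyadic_matrix r \<chi>))) = 4 ^ r * (w * q ^ (r + 1)\<^sup>2)" .
  have "(\<Sum>\<chi>\<in>\<Omega>. real (card (dyadic_matrix r \<chi>)))
      = (\<Sum>\<chi>\<in>bad. real (card (dyadic_matrix r \<chi>))) + (\<Sum>\<chi>\<in>\<Omega> - bad. real (card (dyadic_matrix r \<chi>)))"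
    using f\<Omega> sum.subset_diff[of bad \<Omega> "\<lambda>\<chi>. real (card (dyadic_matrix r \<chi>))"]
    unfolding bad_def by auto
  also have "\<dots> \<le> (\<Sum>\<chi>\<in>bad. 4 ^ r) + (\<Sum>\<chi>\<in>\<Omega> - bad. 4 ^ r * q ^ (r + 1)\<^sup>2 / 4)"
  proof (intro add_mono sum_mono)
    fix \<chi> assume "\<chi> \<in> \<Omega> - bad"
    then have "\<not> grid l (dyadic_matrix r \<chi>)" unfolding bad_def by auto
    then show "real (card (dyadic_matrix r \<chi>)) \<le> 4 ^ r * q ^ (r + 1)\<^sup>2 / 4" using sparse by (intro less_imp_le)
  next
    fix \<chi> show "real (card (dyadic_matrix r \<chi>)) \<le> 4 ^ r"
      using card_mono[OF fc(1) dm[of \<chi>]] fc(2) by (metis of_nat_le_iff of_nat_numeral of_nat_power)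
  qed
  also have "\<dots> \<le> (w * q ^ (r + 1)\<^sup>2 / 2) * 4 ^ r + w * (4 ^ r * q ^ (r + 1)\<^sup>2 / 4)"
  proof (rule add_mono)
    show "(\<Sum>\<chi>\<in>bad. 4 ^ r) \<le> (w * q ^ (r + 1)\<^sup>2 / 2) * 4 ^ r"
      using mult_right_mono[OF bad_le, of "4 ^ r"] by simp
    have "real (card (\<Omega> - bad)) \<le> w"
      using card_mono[OF f\<Omega>, of "\<Omega> - bad"] card\<Omega> by auto
    then show "(\<Sum>\<chi>\<in>\<Omega> - bad. 4 ^ r * q ^ (r + 1)\<^sup>2 / 4) \<le> w * (4 ^ r * q ^ (r + 1)\<^sup>2 / 4)"
      using q0 by (simp add: mult_right_mono)
  qed
  also have "\<dots> = 4 ^ r * (w * q ^ (r + 1)\<^sup>2) * (3 / 4)" by (simp add: field_simps)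
  finally have "4 ^ r * (w * q ^ (r + 1)\<^sup>2) \<le> 4 ^ r * (w * q ^ (r + 1)\<^sup>2) * (3 / 4)"
    unfolding total .
  moreover have "4 ^ r * (w * q ^ (r + 1)\<^sup>2) > 0" using w0 q0 by (intro mult_pos_pos zero_less_power) auto
  ultimately show False by linarith
qed

section \<open>From matrices to permutations\<close>

text \<open>The element itself is counted, so ranks start at 1, as positions and values of
  permutations do.\<close>

definition rank :: "('a \<Rightarrow> nat) \<Rightarrow> 'a set \<Rightarrow> 'a \<Rightarrow> nat" where
  "rank \<kappa> S c = card {d \<in> S. \<kappa> d \<le> \<kappa> c}"

lemma rank_less_iff:
  assumes "finite S" "c \<in> S" "d \<in> S"
  shows "rank \<kappa> S c < rank \<kappa> S d \<longleftrightarrow> \<kappa> c < \<kappa> d"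
proof
  assume "\<kappa> c < \<kappa> d"
  then have "{e \<in> S. \<kappa> e \<le> \<kappa> c} \<subseteq> {e \<in> S. \<kappa> e \<le> \<kappa> d}"
    "d \<in> {e \<in> S. \<kappa> e \<le> \<kappa> d} - {e \<in> S. \<kappa> e \<le> \<kappa> c}" using assms by auto
  then have "{e \<in> S. \<kappa> e \<le> \<kappa> c} \<subset> {e \<in> S. \<kappa> e \<le> \<kappa> d}" by blast
  then show "rank \<kappa> S c < rank \<kappa> S d" unfolding rank_def using assms by (intro psubset_card_mono) auto
next
  assume "rank \<kappa> S c < rank \<kappa> S d"
  moreover have "rank \<kappa> S d \<le> rank \<kappa> S c" if "\<kappa> d \<le> \<kappa> c"
    unfolding rank_def using assms that by (intro card_mono) auto
  ultimately show "\<kappa> c < \<kappa> d" by (meson not_less)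
qed

lemma rank_bij_betw:
  assumes "finite S" "inj_on \<kappa> S"
  shows "bij_betw (rank \<kappa> S) S {1..card S}"
proof -
  have inj: "inj_on (rank \<kappa> S) S"
  proof (rule inj_onI)
    fix c d assume a: "c \<in> S" "d \<in> S" "rank \<kappa> S c = rank \<kappa> S d"
    then have "\<kappa> c = \<kappa> d"
      using rank_less_iff[OF assms(1), of c d \<kappa>] rank_less_iff[OF assms(1), of d c \<kappa>] by auto
    then show "c = d" using assms(2) a by (auto dest: inj_onD)
  qed
  have "rank \<kappa> S ` S \<subseteq> {1..card S}"
  proof
    fix i assume "i \<in> rank \<kappa> S ` S"
    then obtain c where c: "c \<in> S" "i = rank \<kappa> S c" by blast
    have "card {d \<in> S. \<kappa> d \<le> \<kappa> c} > 0" using assms(1) c by (subst card_gt_0_iff) auto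
    moreover have "card {d \<in> S. \<kappa> d \<le> \<kappa> c} \<le> card S" using assms(1) by (intro card_mono) auto
    ultimately show "i \<in> {1..card S}" unfolding c rank_def by simp
  qed
  then have "rank \<kappa> S ` S = {1..card S}"
    using inj by (intro card_subset_eq) (auto simp: card_image)
  then show ?thesis using inj unfolding bij_betw_def by blast
qed

definition row_key :: "nat \<Rightarrow> nat \<times> nat \<Rightarrow> nat" where "row_key N c = fst c * N + snd c"
definition col_key :: "nat \<Rightarrow> nat \<times> nat \<Rightarrow> nat" where "col_key N c = snd c * N + fst c"

lemma lex_key_less:
  fixes a b a' b' N :: nat
  assumes "b < N" "b' < N"
  shows "a * N + b < a' * N + b' \<longleftrightarrow> a < a' \<or> a = a' \<and> b < b'"
proof -
  have lt: "c * N + d < c' * N + d'" if "c < c'" "d < N" for c c' d d'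
  proof -
    have "(c + 1) * N \<le> c' * N" using that by (intro mult_le_mono1) simp
    then show ?thesis using that by simp
  qed
  show ?thesis
    using lt[of a a' b b'] lt[of a' a b' b] assms by (cases a a' rule: linorder_cases) auto
qed

lemma row_key_less:
  "snd c < N \<Longrightarrow> snd d < N \<Longrightarrow> row_key N c < row_key N d \<longleftrightarrow> fst c < fst d \<or> fst c = fst d \<and> snd c < snd d"
  unfolding row_key_def by (rule lex_key_less)

lemma col_key_less:
  "fst c < N \<Longrightarrow> fst d < N \<Longrightarrow> col_key N c < col_key N d \<longleftrightarrow> snd c < snd d \<or> snd c = snd d \<and> fst c < fst d"
  unfolding col_key_def by (rule lex_key_less)

lemma inj_on_keys:
  assumes "S \<subseteq> {..<N} \<times> {..<N}"
  shows "inj_on (row_key N) S" "inj_on (col_key N) S"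
proof -
  have b: "fst c < N \<and> snd c < N" if "c \<in> S" for c using assms that by auto
  show "inj_on (row_key N) S"
  proof (rule inj_onI)
    fix c d assume a: "c \<in> S" "d \<in> S" "row_key N c = row_key N d"
    then show "c = d"
      using row_key_less[of c N d] row_key_less[of d N c] b[of c] b[of d] by (auto simp: prod_eq_iff)
  qed
  show "inj_on (col_key N) S"
  proof (rule inj_onI)
    fix c d assume a: "c \<in> S" "d \<in> S" "col_key N c = col_key N d"
    then show "c = d"
      using col_key_less[of c N d] col_key_less[of d N c] b[of c] b[of d] by (auto simp: prod_eq_iff)
  qed
qed

definition row_rank :: "nat \<Rightarrow> (nat \<times> nat) set \<Rightarrow> nat \<times> nat \<Rightarrow> nat" where
  "row_rank N S = rank (row_key N) S"
definition col_rank :: "nat \<Rightarrow> (nat \<times> nat) set \<Rightarrow> nat \<times> nat \<Rightarrow> nat" where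
  "col_rank N S = rank (col_key N) S"

text \<open>Each row and each column of the matrix is expanded into an increasing sequence: positions are
  ranks in the order by row and then column, values are ranks in the order by column and then row.\<close>

definition inflate :: "nat \<Rightarrow> (nat \<times> nat) set \<Rightarrow> nat \<Rightarrow> nat" where
  "inflate N S i = (if i \<in> {1..N} then col_rank N S (inv_into S (row_rank N S) i) else i)"

context
  fixes N :: nat and S :: "(nat \<times> nat) set"
  assumes S: "S \<subseteq> {..<N} \<times> {..<N}" "card S = N"
begin

lemma finite_cells: "finite S" using S(1) by (rule finite_subset) simp

lemma cells_bound: "c \<in> S \<Longrightarrow> fst c < N \<and> snd c < N"
  using S(1) by auto

lemma bij_betw_ranks: "bij_betw (row_rank N S) S {1..N}" "bij_betw (col_rank N S) S {1..N}"
  using rank_bij_betw[OF finite_cells] inj_on_keys[OF S(1)] S(2) unfolding row_rank_def col_rank_def by auto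

lemma row_rank_less: "c \<in> S \<Longrightarrow> d \<in> S \<Longrightarrow>
  row_rank N S c < row_rank N S d \<longleftrightarrow> fst c < fst d \<or> fst c = fst d \<and> snd c < snd d"
  unfolding row_rank_def using rank_less_iff[OF finite_cells] row_key_less[of c N d] cells_bound[of c] cells_bound[of d] by simp

lemma col_rank_less: "c \<in> S \<Longrightarrow> d \<in> S \<Longrightarrow>
  col_rank N S c < col_rank N S d \<longleftrightarrow> snd c < snd d \<or> snd c = snd d \<and> fst c < fst d"
  unfolding col_rank_def using rank_less_iff[OF finite_cells] col_key_less[of c N d] cells_bound[of c] cells_bound[of d] by simp

lemma inflate_row_rank: "c \<in> S \<Longrightarrow> inflate N S (row_rank N S c) = col_rank N S c"
  using bij_betw_ranks(1) unfolding inflate_def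
  by (simp add: bij_betw_def inv_into_f_f) (metis imageI atLeastAtMost_iff One_nat_def)

lemma inflate_permutes: "inflate N S permutes {1..N}"
proof (rule bij_imp_permutes)
  have "bij_betw (col_rank N S \<circ> inv_into S (row_rank N S)) {1..N} {1..N}"
    by (rule bij_betw_trans[OF bij_betw_inv_into[OF bij_betw_ranks(1)] bij_betw_ranks(2)])
  then show "bij_betw (inflate N S) {1..N} {1..N}"
    by (rule iffD2[OF bij_betw_cong, rotated]) (simp add: inflate_def)
next
  fix x assume "x \<notin> {1..N}"
  then show "inflate N S x = x" unfolding inflate_def by (rule if_not_P)
qed

lemma perm_points_inflate: "perm_points N (inflate N S) = (\<lambda>c. (row_rank N S c, col_rank N S c)) ` S"
proof -
  have "{1..N} = row_rank N S ` S" using bij_betw_ranks(1) by (simp add: bij_betw_def)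
  then show ?thesis unfolding perm_points_def by (simp add: image_image inflate_row_rank)
qed

text \<open>Of any three consecutive row intervals of a grid, the last two cannot lie in a single expanded row,
  since its points are increasing and cannot contain a grid of size 2. So every third interval
  survives the contraction.\<close>

lemma grid_inflate:
  assumes "grid (3 * l) (perm_points N (inflate N S))"
  shows "grid l S"
proof -
  from assms obtain p where p0: "grid_at (3 * l) (perm_points N (inflate N S)) p"
    unfolding grid_def by blast
  note p = grid_atD[OF p0]
  have "\<forall>i j. \<exists>c. i < 3 * l \<longrightarrow> j < 3 * l \<longrightarrow> c \<in> S \<and> p i j = (row_rank N S c, col_rank N S c)"
  proof (intro allI)
    fix i j
    show "\<exists>c. i < 3 * l \<longrightarrow> j < 3 * l \<longrightarrow> c \<in> S \<and> p i j = (row_rank N S c, col_rank N S c)"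
      using p(1)[of i j] unfolding perm_points_inflate by (cases "i < 3 * l \<and> j < 3 * l") auto
  qed
  then obtain c where c: "\<And>i j. i < 3 * l \<Longrightarrow> j < 3 * l \<Longrightarrow>
      c i j \<in> S \<and> p i j = (row_rank N S (c i j), col_rank N S (c i j))"
    by metis
  have row: "fst (c i j) < fst (c i' j') \<or> fst (c i j) = fst (c i' j') \<and> snd (c i j) < snd (c i' j')"
    if "i < i'" "i' < 3 * l" "j < 3 * l" "j' < 3 * l" for i i' j j'
    using p(2)[OF that] c[of i j] c[of i' j'] row_rank_less[of "c i j" "c i' j'"] that by auto
  have col: "snd (c i j) < snd (c i' j') \<or> snd (c i j) = snd (c i' j') \<and> fst (c i j) < fst (c i' j')"
    if "j < j'" "i < 3 * l" "i' < 3 * l" "j' < 3 * l" for i i' j j'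
    using p(3)[OF that] c[of i j] c[of i' j'] col_rank_less[of "c i j" "c i' j'"] that by auto
  show ?thesis
  proof (rule gridI[of _ "\<lambda>i j. c (3 * i) (3 * j)"])
    fix i j assume "i < l" "j < l"
    then show "c (3 * i) (3 * j) \<in> S" using c by simp
  next
    fix i i' j j' assume a: "i < i'" "i' < l" "j < l" "j' < l"
    have "fst (c (3 * i) (3 * j)) \<le> fst (c (3 * i + 1) 1)"
      using row[of "3 * i" "3 * i + 1" "3 * j" 1] a by auto
    \<comment> \<open>If the rows were equal, the column of the first cell would be smaller than
      that of the second; but the first cell lies in the later of the two column intervals.\<close>
    moreover have "fst (c (3 * i + 1) 1) < fst (c (3 * i + 2) 0)"
      using row[of "3 * i + 1" "3 * i + 2" 1 0] col[of 0 1 "3 * i + 2" "3 * i + 1"] a by auto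
    moreover have "fst (c (3 * i + 2) 0) \<le> fst (c (3 * i') (3 * j'))"
      using row[of "3 * i + 2" "3 * i'" 0 "3 * j'"] a by auto
    ultimately show "fst (c (3 * i) (3 * j)) < fst (c (3 * i') (3 * j'))" by linarith
  next
    fix i i' j j' assume a: "j < j'" "i < l" "i' < l" "j' < l"
    have "snd (c (3 * i) (3 * j)) \<le> snd (c 1 (3 * j + 1))"
      using col[of "3 * j" "3 * j + 1" "3 * i" 1] a by auto
    moreover have "snd (c 1 (3 * j + 1)) < snd (c 0 (3 * j + 2))"
      using col[of "3 * j + 1" "3 * j + 2" 1 0] row[of 0 1 "3 * j + 2" "3 * j + 1"] a by auto
    moreover have "snd (c 0 (3 * j + 2)) \<le> snd (c (3 * i') (3 * j'))"
      using col[of "3 * j + 2" "3 * j'" 0 "3 * i'"] a by auto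
    ultimately show "snd (c (3 * i) (3 * j)) < snd (c (3 * i') (3 * j'))" by linarith
  qed
qed

text \<open>Adding \<open>i\<close> makes these weakly increasing sequences strictly increasing, so that they are
  encoded by subsets of \<open>{..<2 * N}\<close>.\<close>

definition row_at :: "nat \<Rightarrow> nat" where "row_at i = fst (inv_into S (row_rank N S) i)"
definition col_at :: "nat \<Rightarrow> nat" where "col_at i = snd (inv_into S (col_rank N S) i)"

lemma row_at: "c \<in> S \<Longrightarrow> row_at (row_rank N S c) = fst c"
  and col_at: "c \<in> S \<Longrightarrow> col_at (col_rank N S c) = snd c"
  using bij_betw_ranks unfolding row_at_def col_at_def by (simp_all add: bij_betw_def inv_into_f_f)

lemma strict_mono_row_at: "strict_mono_on {1..N} (\<lambda>i. row_at i + i)"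
proof (rule strict_mono_onI)
  fix i j assume a: "i \<in> {1..N}" "j \<in> {1..N}" "i < j"
  then obtain c d where "c \<in> S" "i = row_rank N S c" "d \<in> S" "j = row_rank N S d"
    using bij_betw_ranks(1) unfolding bij_betw_def by blast
  then show "row_at i + i < row_at j + j" using row_rank_less[of c d] a(3) by (auto simp: row_at)
qed

lemma strict_mono_col_at: "strict_mono_on {1..N} (\<lambda>i. col_at i + i)"
proof (rule strict_mono_onI)
  fix i j assume a: "i \<in> {1..N}" "j \<in> {1..N}" "i < j"
  then obtain c d where "c \<in> S" "i = col_rank N S c" "d \<in> S" "j = col_rank N S d"
    using bij_betw_ranks(2) unfolding bij_betw_def by blast
  then show "col_at i + i < col_at j + j" using col_rank_less[of c d] a(3) by (auto simp: col_at)
qed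

text \<open>Decoding: the permutation together with the row and column sequences determines
  \<open>S\<close>.\<close>

lemma cells_eq_image_inflate: "S = (\<lambda>i. (row_at i, col_at (inflate N S i))) ` {1..N}"
proof -
  have "{1..N} = row_rank N S ` S" using bij_betw_ranks(1) by (simp add: bij_betw_def)
  then show ?thesis by (simp add: image_image inflate_row_rank row_at col_at)
qed

lemma row_at_bound: "i \<in> {1..N} \<Longrightarrow> row_at i + i < 2 * N"
proof -
  assume i: "i \<in> {1..N}"
  then obtain c where "c \<in> S" "i = row_rank N S c" using bij_betw_ranks(1) unfolding bij_betw_def by blast
  then have "row_at i < N" using S(1) by (auto simp: row_at)
  then show ?thesis using i by auto
qed

lemma col_at_bound: "i \<in> {1..N} \<Longrightarrow> col_at i + i < 2 * N"
proof -
  assume i: "i \<in> {1..N}"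
  then obtain c where "c \<in> S" "i = col_rank N S c" using bij_betw_ranks(2) unfolding bij_betw_def by blast
  then have "col_at i < N" using S(1) by (auto simp: col_at)
  then show ?thesis using i by auto
qed

end

text \<open>A strictly increasing sequence is the sorted enumeration of its range.\<close>

lemma strict_mono_on_eq_of_image_eq:
  fixes f g :: "nat \<Rightarrow> nat"
  assumes "strict_mono_on {1..N} f" "strict_mono_on {1..N} g" "f ` {1..N} = g ` {1..N}" "i \<in> {1..N}"
  shows "f i = g i"
proof -
  have sorted: "sorted_wrt (<) (map h [1..<Suc N])" if "strict_mono_on {1..N} h" for h :: "nat \<Rightarrow> nat"
    unfolding sorted_wrt_map
    by (rule sorted_wrt_mono_rel[OF _ sorted_wrt_upt]) (use that in \<open>auto intro: strict_mono_onD\<close>)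
  have "set [1..<Suc N] = {1..N}" by auto
  then have "map f [1..<Suc N] = map g [1..<Suc N]"
    using sorted[OF assms(1)] sorted[OF assms(2)] assms(3)
    by (intro strict_sorted_equal) (simp_all del: upt_Suc)
  then show ?thesis using assms(4) by (simp del: upt_Suc)
qed

text \<open>Each \<open>N\<close>-subset of \<open>A\<close> inflates to a permutation without a
  grid of size \<open>3 * l\<close>. The subset is recovered from the permutation and the two
  coordinate sequences, each encoded by a subset of \<open>{..<2 * N}\<close>, so at most
  \<open>16 ^ N\<close> subsets share a permutation.\<close>

lemma card_grid_free_perms_ge:
  assumes A: "A \<subseteq> {..<N} \<times> {..<N}" "\<not> grid l A"
  shows "card A choose N \<le> card {\<sigma>. \<sigma> permutes {1..N} \<and> \<not> grid (3 * l) (perm_points N \<sigma>)} * 16 ^ N"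
proof -
  define \<S> where "\<S> = {S. S \<subseteq> A \<and> card S = N}"
  define \<P> where "\<P> = {\<sigma>. \<sigma> permutes {1..N} \<and> \<not> grid (3 * l) (perm_points N \<sigma>)}"
  define \<Phi> where "\<Phi> S = (inflate N S, (\<lambda>i. row_at N S i + i) ` {1..N}, (\<lambda>i. col_at N S i + i) ` {1..N})" for S
  have fA: "finite A" using A(1) by (rule finite_subset) simp
  have S: "S \<subseteq> {..<N} \<times> {..<N}" "card S = N" "S \<subseteq> A" if "S \<in> \<S>" for S
    using that A(1) unfolding \<S>_def by auto
  have fP: "finite \<P>" unfolding \<P>_def by (rule finite_subset[OF _ finite_permutations[of "{1..N}"]]) auto
  have "card \<S> \<le> card (\<P> \<times> Pow {..<2 * N} \<times> Pow {..<2 * N})"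
  proof (rule card_inj_on_le[of \<Phi>])
    show "inj_on \<Phi> \<S>"
    proof (rule inj_onI)
      fix S T assume ST: "S \<in> \<S>" "T \<in> \<S>" and eq: "\<Phi> S = \<Phi> T"
      have inf: "inflate N S = inflate N T" using eq unfolding \<Phi>_def by simp
      have r: "row_at N S i = row_at N T i" if "i \<in> {1..N}" for i
        using strict_mono_on_eq_of_image_eq[OF strict_mono_row_at[OF S(1,2)[OF ST(1)]]
            strict_mono_row_at[OF S(1,2)[OF ST(2)]] _ that] eq unfolding \<Phi>_def by simp
      have c: "col_at N S i = col_at N T i" if "i \<in> {1..N}" for i
        using strict_mono_on_eq_of_image_eq[OF strict_mono_col_at[OF S(1,2)[OF ST(1)]]
            strict_mono_col_at[OF S(1,2)[OF ST(2)]] _ that] eq unfolding \<Phi>_def by simp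
      have "inflate N S i \<in> {1..N}" if "i \<in> {1..N}" for i
        using permutes_in_image[OF inflate_permutes[OF S(1,2)[OF ST(1)]]] that by blast
      then have "(\<lambda>i. (row_at N S i, col_at N S (inflate N S i))) ` {1..N}
          = (\<lambda>i. (row_at N T i, col_at N T (inflate N T i))) ` {1..N}"
        using r c by (intro image_cong) (auto simp flip: inf)
      then show "S = T" using cells_eq_image_inflate[OF S(1,2)[OF ST(1)]] cells_eq_image_inflate[OF S(1,2)[OF ST(2)]] by simp
    qed
    show "\<Phi> ` \<S> \<subseteq> \<P> \<times> Pow {..<2 * N} \<times> Pow {..<2 * N}"
    proof
      fix z assume "z \<in> \<Phi> ` \<S>"
      then obtain T where T: "T \<in> \<S>" "z = \<Phi> T" by blast
      have "\<not> grid (3 * l) (perm_points N (inflate N T))"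
        using grid_inflate[OF S(1,2)[OF T(1)]] grid_subset[OF _ S(3)[OF T(1)]] A(2) by blast
      then show "z \<in> \<P> \<times> Pow {..<2 * N} \<times> Pow {..<2 * N}"
        unfolding T \<Phi>_def \<P>_def using inflate_permutes[OF S(1,2)[OF T(1)]]
          row_at_bound[OF S(1,2)[OF T(1)]] col_at_bound[OF S(1,2)[OF T(1)]] by auto
    qed
    show "finite (\<P> \<times> Pow {..<2 * N} \<times> Pow {..<2 * N})" using fP by simp
  qed
  moreover have "card \<S> = card A choose N" unfolding \<S>_def using fA by (rule n_subsets)
  moreover have "card (\<P> \<times> Pow {..<2 * N} \<times> Pow {..<2 * N}) = card \<P> * 16 ^ N"
  proof -
    have "(2::nat) ^ (2 * N) * 2 ^ (2 * N) = 16 ^ N" by (simp add: power_mult flip: power_mult_distrib)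
    then show ?thesis by (simp add: card_cartesian_product card_Pow)
  qed
  ultimately show ?thesis unfolding \<P>_def by simp
qed

section \<open>Typical permutations contain large grids\<close>

text \<open>Once the image \<open>b\<close> of a point \<open>a\<close> of \<open>I\<close> is
  fixed, composing with the transposition of \<open>a\<close> and \<open>b\<close> leaves a
  permutation of \<open>S - {a}\<close> and a forbidden set of the same size. In the smaller ground
  set the forbidden fraction is no smaller, so every point of \<open>I\<close> contributes at most
  the same factor.\<close>

lemma card_permutes_avoiding_le:
  assumes "finite S" "I \<subseteq> S" "J \<subseteq> S"
  shows "real (card {\<sigma>. \<sigma> permutes S \<and> \<sigma> ` I \<inter> J = {}})
    \<le> (1 - real (card J) / real (card S)) ^ card I * fact (card S)"
  using assms
proof (induction "card I" arbitrary: S I J)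
  case 0
  then have "I = {}" using finite_subset[of I S] by auto
  then show ?case using 0 by (simp add: card_permutations[OF refl])
next
  case (Suc m)
  have fin: "finite I" "finite J" using Suc.prems finite_subset by blast+
  obtain a where a: "a \<in> I" using Suc.hyps(2) by fastforce
  then have aS: "a \<in> S" using Suc.prems by blast
  define k where "k = card S"
  define F where "F S I J = {\<sigma>. \<sigma> permutes S \<and> \<sigma> ` I \<inter> J = {}}" for S I J :: "'a set"
  have finF: "finite (F S I J)" if "finite S" for S I J
    unfolding F_def by (rule finite_subset[OF _ finite_permutations[OF that]]) auto
  have jk: "card J \<le> k" unfolding k_def using Suc.prems by (intro card_mono)
  have k0: "k > 0" unfolding k_def using aS Suc.prems(1) card_gt_0_iff by blast
  have each: "real (card {\<sigma> \<in> F S I J. \<sigma> a = b})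
      \<le> (1 - real (card J) / real k) ^ m * fact (k - 1)" if b: "b \<in> S - J" for b
  proof -
    \<comment> \<open>The transposition sends only \<open>b\<close> to \<open>a\<close>; as
      \<open>b\<close> is outside \<open>J\<close>, the set \<open>J'\<close> misses
      \<open>a\<close>.\<close>
    define J' where "J' = transpose a b ` J"
    define \<Phi> where "\<Phi> \<sigma> = transpose a b \<circ> \<sigma>" for \<sigma> :: "'a \<Rightarrow> 'a"
    have J': "J' \<subseteq> S - {a}"
    proof
      fix y assume "y \<in> J'"
      then obtain x where "x \<in> J" "y = transpose a b x" unfolding J'_def by blast
      then show "y \<in> S - {a}" using b aS Suc.prems(3) by (auto simp: transpose_def)
    qed
    have cJ': "card J' = card J" unfolding J'_def by (intro card_image) (auto intro: inj_on_subset[OF inj_transpose])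
    have "card {\<sigma> \<in> F S I J. \<sigma> a = b} \<le> card (F (S - {a}) (I - {a}) J')"
    proof (rule card_inj_on_le[of \<Phi>])
      show "inj_on \<Phi> {\<sigma> \<in> F S I J. \<sigma> a = b}"
      proof (rule inj_onI)
        fix \<sigma> \<tau> assume "\<Phi> \<sigma> = \<Phi> \<tau>"
        then have "transpose a b \<circ> (transpose a b \<circ> \<sigma>) = transpose a b \<circ> (transpose a b \<circ> \<tau>)"
          unfolding \<Phi>_def by simp
        then show "\<sigma> = \<tau>" by (simp add: fun_eq_iff)
      qed
      show "\<Phi> ` {\<sigma> \<in> F S I J. \<sigma> a = b} \<subseteq> F (S - {a}) (I - {a}) J'"
      proof (rule image_subsetI)
        fix \<sigma> assume \<sigma>: "\<sigma> \<in> {\<sigma> \<in> F S I J. \<sigma> a = b}"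
        have p: "transpose a b permutes S" using aS b by (intro permutes_swap_id) auto
        have "\<Phi> \<sigma> permutes S"
          unfolding \<Phi>_def using \<sigma> p unfolding F_def by (auto intro: permutes_compose)
        then have "\<Phi> \<sigma> permutes (S - {a})"
          by (rule permutes_superset) (use \<sigma> in \<open>auto simp: \<Phi>_def\<close>)
        moreover have "\<Phi> \<sigma> ` (I - {a}) \<inter> J' = {}"
        proof -
          have "\<Phi> \<sigma> x \<notin> J'" if "x \<in> I" for x
          proof
            assume "\<Phi> \<sigma> x \<in> J'"
            then obtain y where y: "y \<in> J" "transpose a b (\<sigma> x) = transpose a b y"
              unfolding \<Phi>_def J'_def by auto
            then have "\<sigma> x = y" using inj_transpose[of a b] by (meson injD)
            then show False using \<sigma> that y unfolding F_def by blast
          qed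
          then show ?thesis by blast
        qed
        ultimately show "\<Phi> \<sigma> \<in> F (S - {a}) (I - {a}) J'" unfolding F_def by blast
      qed
      show "finite (F (S - {a}) (I - {a}) J')" using finF Suc.prems(1) by simp
    qed
    then have "real (card {\<sigma> \<in> F S I J. \<sigma> a = b}) \<le> real (card (F (S - {a}) (I - {a}) J'))" by simp
    also have "\<dots> \<le> (1 - real (card J') / real (card (S - {a}))) ^ card (I - {a}) * fact (card (S - {a}))"
      unfolding F_def
      by (rule Suc.hyps(1)) (use Suc.hyps(2) Suc.prems fin a J' in auto)
    also have "\<dots> = (1 - real (card J) / real (k - 1)) ^ m * fact (k - 1)"
    proof -
      have "card (I - {a}) = m" using Suc.hyps(2) fin a by simp
      then show ?thesis using Suc.prems(1) aS cJ' unfolding k_def by simp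
    qed
    also have "\<dots> \<le> (1 - real (card J) / real k) ^ m * fact (k - 1)"
    proof (intro mult_right_mono power_mono)
      have "card J' \<le> card (S - {a})" using J' Suc.prems(1) by (intro card_mono) auto
      then have jk1: "card J \<le> k - 1" unfolding cJ' k_def using aS Suc.prems(1) by simp
      \<comment> \<open>For \<open>k = 1\<close> the denominator is 0 and the quotient is 0 by
        convention; \<open>J\<close> is then empty.\<close>
      show "0 \<le> 1 - real (card J) / real (k - 1)"
        using jk1 by (cases "k = 1") (auto simp: divide_simps)
      show "1 - real (card J) / real (k - 1) \<le> 1 - real (card J) / real k"
        using jk1 by (cases "k \<le> 1") (auto intro!: divide_left_mono)
    qed simp
    finally show ?thesis .
  qed
  have "F S I J \<subseteq> (\<Union>b\<in>S - J. {\<sigma> \<in> F S I J. \<sigma> a = b})"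
  proof
    fix \<sigma> assume \<sigma>: "\<sigma> \<in> F S I J"
    then have "\<sigma> a \<in> S - J" using a aS permutes_in_image[of \<sigma> S a] unfolding F_def by blast
    then show "\<sigma> \<in> (\<Union>b\<in>S - J. {\<sigma> \<in> F S I J. \<sigma> a = b})" using \<sigma> by blast
  qed
  then have "card (F S I J) \<le> card (\<Union>b\<in>S - J. {\<sigma> \<in> F S I J. \<sigma> a = b})"
    using Suc.prems(1) finF by (intro card_mono) auto
  also have "\<dots> \<le> (\<Sum>b\<in>S - J. card {\<sigma> \<in> F S I J. \<sigma> a = b})"
    using Suc.prems(1) by (intro card_UN_le) auto
  finally have "real (card (F S I J)) \<le> (\<Sum>b\<in>S - J. real (card {\<sigma> \<in> F S I J. \<sigma> a = b}))"
    unfolding of_nat_sum[symmetric] of_nat_le_iff .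
  also have "\<dots> \<le> (\<Sum>b\<in>S - J. (1 - real (card J) / real k) ^ m * fact (k - 1))"
    using each by (rule sum_mono)
  also have "\<dots> = (real k - real (card J)) * ((1 - real (card J) / real k) ^ m * fact (k - 1))"
    using fin Suc.prems jk by (simp add: card_Diff_subset k_def of_nat_diff)
  also have "\<dots> = (1 - real (card J) / real k) ^ Suc m * (real k * fact (k - 1))"
    using k0 by (simp add: field_simps)
  also have "real k * fact (k - 1) = fact k" using k0 by (simp add: fact_reduce)
  finally show ?case using Suc.hyps(2) unfolding F_def k_def by simp
qed

text \<open>The conditions at both ends rule out decompositions near the ends, which the blocks do not see.\<close>

definition typical :: "nat \<Rightarrow> nat \<Rightarrow> nat \<Rightarrow> (nat \<Rightarrow> nat) set" where
  "typical b l k = {\<pi>. \<pi> permutes {1..k} \<and>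
     (\<forall>i<l. \<forall>j<l. \<exists>x\<in>{i * b<..i * b + b}. \<pi> x \<in> {j * b<..j * b + b}) \<and> b < \<pi> 1 \<and> \<pi> k \<le> (l - 1) * b}"

lemma grid_typical:
  assumes "\<pi> \<in> typical b l k" "l * b \<le> k"
  shows "grid l (perm_points k \<pi>)"
proof -
  have "\<forall>i j. \<exists>x. i < l \<longrightarrow> j < l \<longrightarrow> x \<in> {i * b<..i * b + b} \<and> \<pi> x \<in> {j * b<..j * b + b}"
    using assms(1) unfolding typical_def by blast
  then obtain x where x: "\<And>i j. i < l \<Longrightarrow> j < l \<Longrightarrow> x i j \<in> {i * b<..i * b + b} \<and> \<pi> (x i j) \<in> {j * b<..j * b + b}"
    by metis
  have le: "i * b + b \<le> j * b" if "i < j" for i j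
    using mult_le_mono1[of "Suc i" j b] that by simp
  show ?thesis
  proof (rule gridI[of _ "\<lambda>i j. (x i j, \<pi> (x i j))"])
    fix i j assume "i < l" "j < l"
    then have "x i j \<in> {1..k}" using x[of i j] le[of i l] assms(2) by auto
    then show "(x i j, \<pi> (x i j)) \<in> perm_points k \<pi>" unfolding perm_points_def by blast
  next
    fix i i' j j' assume a: "i < i'" "i' < l" "j < l" "j' < l"
    then show "fst (x i j, \<pi> (x i j)) < fst (x i' j', \<pi> (x i' j'))"
      using x[of i j] x[of i' j'] le[of i i'] by simp
  next
    fix i i' j j' assume a: "j < j'" "i < l" "i' < l" "j' < l"
    then show "snd (x i j, \<pi> (x i j)) < snd (x i' j', \<pi> (x i' j'))"
      using x[of i j] x[of i' j'] le[of j j'] by simp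
  qed
qed

text \<open>A point of the first block with value in the top block and a point of the last block
  with value in the bottom block form an inversion across every cut between these blocks. For
  earlier cuts position 1, and for later cuts position \<open>k\<close>, replaces the point on the
  wrong side; the end conditions make this an inversion.\<close>

lemma indec_typical:
  assumes \<pi>: "\<pi> \<in> typical b l k" and lb: "l * b \<le> k" and l: "l \<ge> 2"
  shows "indec k \<pi>"
  unfolding indec_def
proof (intro allI impI)
  fix i assume i: "1 \<le> i \<and> i < k"
  have blk: "\<exists>x\<in>{i * b<..i * b + b}. \<pi> x \<in> {j * b<..j * b + b}" if "i < l" "j < l" for i j
    using \<pi> that unfolding typical_def by blast
  have ends: "b < \<pi> 1" "\<pi> k \<le> (l - 1) * b" using \<pi> unfolding typical_def by blast+
  have lb': "(l - 1) * b + b = l * b" "b \<le> (l - 1) * b" using l by (cases l; simp)+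
  from blk[of 0 "l - 1"] l obtain s where s: "0 < s" "s \<le> b" "(l - 1) * b < \<pi> s" by auto
  from blk[of "l - 1" 0] l obtain t where t: "(l - 1) * b < t" "t \<le> (l - 1) * b + b" "\<pi> t \<le> b" by auto
  consider "i < b" | "b \<le> i" "i \<le> (l - 1) * b" | "(l - 1) * b < i" by linarith
  then show "\<exists>s\<in>{1..i}. \<exists>t\<in>{Suc i..k}. \<pi> t < \<pi> s"
  proof cases
    case 1
    then have "Suc i \<le> t" "t \<le> k" "\<pi> t < \<pi> 1" using i t lb lb' ends by linarith+
    then show ?thesis using i by (intro bexI[of _ 1] bexI[of _ t]) auto
  next
    case 2
    then have "Suc i \<le> t" "t \<le> k" "\<pi> t < \<pi> s" "s \<le> i" "1 \<le> s" using s t lb lb' by linarith+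
    then show ?thesis by (intro bexI[of _ s] bexI[of _ t]) auto
  next
    case 3
    then have "\<pi> k < \<pi> s" "s \<le> i" "1 \<le> s" using s lb' ends by linarith+
    then show ?thesis using i by (intro bexI[of _ s] bexI[of _ k]) auto
  qed
qed

text \<open>Union bound over the ways to fail: one of \<open>l\<^sup>2\<close> boxes is missed, the
  first value is at most \<open>b\<close>, or the last value exceeds
  \<open>(l - 1) * b\<close>.\<close>

lemma card_typical_ge:
  assumes lb: "l * b \<le> k" and k: "k > 0" and l: "l > 0"
  shows "fact k * (1 - (real (l\<^sup>2) * (1 - real b / real k) ^ b + real b / real k + (1 - real ((l - 1) * b) / real k)))
    \<le> real (card (typical b l k))"
proof -
  define Perm where "Perm = {\<pi>. \<pi> permutes {1..k}}"
  define F where "F I J = {\<sigma>. \<sigma> permutes {1..k} \<and> \<sigma> ` I \<inter> J = {}}" for I J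
  have fP: "finite Perm" "card Perm = fact k" unfolding Perm_def
    by (auto simp: finite_permutations card_permutations)
  have fF: "finite (F I J)" for I J unfolding F_def by (rule finite_subset[OF _ fP(1)]) (auto simp: Perm_def)
  define Blk where "Blk i = {i * b<..i * b + b}" for i
  have bk: "b \<le> k" "(l - 1) * b \<le> k" using lb l by (cases l; simp)+
  have BlkS: "Blk i \<subseteq> {1..k}" if "i < l" for i
  proof -
    have "i * b + b \<le> l * b" using mult_le_mono1[of "Suc i" l b] that by simp
    then show ?thesis unfolding Blk_def using lb by auto
  qed
  have "Perm - typical b l k \<subseteq> (\<Union>(i, j)\<in>{..<l} \<times> {..<l}. F (Blk i) (Blk j)) \<union> (F {1} {b<..k} \<union> F {k} {1..(l - 1) * b})"
  proof
    fix \<pi> assume \<pi>: "\<pi> \<in> Perm - typical b l k"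
    then have p: "\<pi> permutes {1..k}" unfolding Perm_def by blast
    have im: "\<pi> 1 \<in> {1..k}" "\<pi> k \<in> {1..k}"
      using permutes_in_image[OF p, of 1] permutes_in_image[OF p, of k] k by auto
    from \<pi> p consider i j where "i < l" "j < l" "\<not> (\<exists>x\<in>Blk i. \<pi> x \<in> Blk j)" | "\<pi> 1 \<le> b" | "\<pi> k > (l - 1) * b"
      unfolding typical_def Blk_def[symmetric] by force
    then show "\<pi> \<in> (\<Union>(i, j)\<in>{..<l} \<times> {..<l}. F (Blk i) (Blk j)) \<union> (F {1} {b<..k} \<union> F {k} {1..(l - 1) * b})"
    proof cases
      case 1
      then have "\<pi> \<in> F (Blk i) (Blk j)" unfolding F_def using p by blast
      then show ?thesis using 1(1,2) by blast
    next
      case 2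
      then have "\<pi> \<in> F {1} {b<..k}" unfolding F_def using p by auto
      then show ?thesis by blast
    next
      case 3
      then have "\<pi> \<in> F {k} {1..(l - 1) * b}" unfolding F_def using p by auto
      then show ?thesis by blast
    qed
  qed
  then have "card (Perm - typical b l k) \<le>
      card ((\<Union>(i, j)\<in>{..<l} \<times> {..<l}. F (Blk i) (Blk j)) \<union> (F {1} {b<..k} \<union> F {k} {1..(l - 1) * b}))"
    using fF by (intro card_mono) auto
  also have "\<dots> \<le> card (\<Union>(i, j)\<in>{..<l} \<times> {..<l}. F (Blk i) (Blk j)) + (card (F {1} {b<..k}) + card (F {k} {1..(l - 1) * b}))"
    by (rule order.trans[OF card_Un_le add_left_mono[OF card_Un_le]])
  also have "\<dots> \<le> (\<Sum>(i, j)\<in>{..<l} \<times> {..<l}. card (F (Blk i) (Blk j))) + (card (F {1} {b<..k}) + card (F {k} {1..(l - 1) * b}))"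
    unfolding case_prod_unfold by (intro add_right_mono card_UN_le) auto
  finally have le: "real (card (Perm - typical b l k)) \<le>
      (\<Sum>(i, j)\<in>{..<l} \<times> {..<l}. real (card (F (Blk i) (Blk j)))) + (real (card (F {1} {b<..k})) + real (card (F {k} {1..(l - 1) * b})))"
    unfolding case_prod_unfold of_nat_sum[symmetric] of_nat_add[symmetric] of_nat_le_iff .
  have F_le: "real (card (F I J)) \<le> (1 - real (card J) / real k) ^ card I * fact k"
    if "I \<subseteq> {1..k}" "J \<subseteq> {1..k}" for I J
    using card_permutes_avoiding_le[of "{1..k}" I J] that unfolding F_def by simp
  have "(\<Sum>(i, j)\<in>{..<l} \<times> {..<l}. real (card (F (Blk i) (Blk j))))
      \<le> (\<Sum>(i, j)\<in>{..<l} \<times> {..<l}. (1 - real b / real k) ^ b * fact k)"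
  proof (rule sum_mono)
    fix z assume "z \<in> {..<l} \<times> {..<l}"
    then show "(case z of (i, j) \<Rightarrow> real (card (F (Blk i) (Blk j))))
        \<le> (case z of (i, j) \<Rightarrow> (1 - real b / real k) ^ b * fact k)"
      using F_le[OF BlkS[of "fst z"] BlkS[of "snd z"]] by (auto simp: Blk_def)
  qed
  also have "\<dots> = real (l\<^sup>2) * (1 - real b / real k) ^ b * fact k"
    by (simp add: card_cartesian_product power2_eq_square)
  finally have 1: "(\<Sum>(i, j)\<in>{..<l} \<times> {..<l}. real (card (F (Blk i) (Blk j)))) \<le> \<dots>" .
  have 2: "real (card (F {1} {b<..k})) \<le> real b / real k * fact k"
  proof -
    have "{b<..k} \<subseteq> {1..k}" by auto
    then show ?thesis using F_le[of "{1}" "{b<..k}"] k bk by (simp add: of_nat_diff diff_divide_distrib)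
  qed
  have 3: "real (card (F {k} {1..(l - 1) * b})) \<le> (1 - real ((l - 1) * b) / real k) * fact k"
    using F_le[of "{k}" "{1..(l - 1) * b}"] k bk by auto
  have sub: "typical b l k \<subseteq> Perm" unfolding typical_def Perm_def by blast
  then have "real (card (Perm - typical b l k)) = fact k - real (card (typical b l k))"
    using fP by (simp add: card_Diff_subset finite_subset of_nat_diff card_mono[OF fP(1) sub, unfolded fP(2)])
  then have "fact k - real (card (typical b l k)) \<le> real (l\<^sup>2) * (1 - real b / real k) ^ b * fact k
     + (real b / real k * fact k + (1 - real ((l - 1) * b) / real k) * fact k)"
    using le 1 2 3 by linarith
  then show ?thesis by (simp add: algebra_simps)
qed

section \<open>Choice of parameters\<close>

text \<open>With \<open>4 * r + 5\<close> colours,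
  \<open>1 / q = 1 + 1 / (4 * (real r + 1))\<close>, so a cell survives with probability at least
  \<open>exp (- ((real r + 1) / 4))\<close>. With this \<open>l\<close>, all products of two given
  families survive with probability at most \<open>exp (- real (l * (4 * r + 1)))\<close>, which
  beats the at most \<open>exp (real (4 * r * l))\<close> pairs of families.\<close>

lemma many_grid_free_perms:
  fixes r :: nat
  assumes r: "r \<ge> 26"
  defines "N \<equiv> 2 ^ r" and "l \<equiv> (4 * r + 5) * (4 * r + 1)"
  shows "(2 powr (real r / 4)) ^ N \<le> real (card {\<sigma>. \<sigma> permutes {1..N} \<and> \<not> grid (3 * l) (perm_points N \<sigma>)})"
proof -
  define Q where "Q = 4 * r + 5"
  define q where "q = 1 - 1 / real Q"
  have Q1: "Q > 1" unfolding Q_def by simp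
  have q_pos: "q > 0" unfolding q_def using Q1 by simp
  then have q0: "q \<ge> 0" by simp
  have "exp (- (1 / (4 * (real r + 1)))) \<le> q"
  proof -
    have "1 / q = 1 + 1 / (4 * (real r + 1))" unfolding q_def Q_def by (simp add: divide_simps algebra_simps)
    also have "\<dots> \<le> exp (1 / (4 * (real r + 1)))" by (rule exp_ge_add_one_self)
    finally have "1 / exp (1 / (4 * (real r + 1))) \<le> q"
      using q_pos by (simp add: field_simps)
    then show ?thesis by (simp add: exp_minus field_simps)
  qed
  then have "exp (- (1 / (4 * (real r + 1)))) ^ (r + 1)\<^sup>2 \<le> q ^ (r + 1)\<^sup>2"
    by (intro power_mono) auto
  also have "exp (- (1 / (4 * (real r + 1)))) ^ (r + 1)\<^sup>2 = exp (- ((real r + 1) / 4))"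
  proof -
    have "real ((r + 1)\<^sup>2) * - (1 / (4 * (real r + 1))) = - ((real r + 1) / 4)"
      by (simp add: power2_eq_square divide_simps) (simp add: algebra_simps)
    then show ?thesis unfolding exp_of_nat_mult[symmetric] by simp
  qed
  finally have q_lower: "exp (- ((real r + 1) / 4)) \<le> q ^ (r + 1)\<^sup>2" .
  have "q \<le> exp (- (1 / real Q))" unfolding q_def using exp_ge_add_one_self[of "- (1 / real Q)"] by simp
  then have "q ^ l\<^sup>2 \<le> exp (- (1 / real Q)) ^ l\<^sup>2" using q0 by (rule power_mono)
  also have "\<dots> = exp (- real (l * (4 * r + 1)))"
  proof -
    have "real (l\<^sup>2) * (1 / real Q) = real (l * (4 * r + 1))"
      unfolding l_def Q_def by (simp add: power2_eq_square field_simps)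
    then show ?thesis by (simp add: exp_of_nat_mult[symmetric] del: of_nat_power)
  qed
  finally have q_upper: "q ^ l\<^sup>2 \<le> exp (- real (l * (4 * r + 1)))" .
  have "card (dyadics r) choose l \<le> card (dyadics r) ^ l"
    by (cases "l \<le> card (dyadics r)") (auto simp: binomial_le_pow binomial_eq_0)
  also have "\<dots> \<le> (4 ^ r) ^ l" using card_dyadics_le by (rule power_mono) simp
  finally have "(card (dyadics r) choose l)\<^sup>2 \<le> ((4 ^ r) ^ l)\<^sup>2" by (rule power_mono) simp
  also have "\<dots> = 2 ^ (4 * r * l)"
  proof -
    have "(4::nat) = 2 ^ 2" by simp
    then show ?thesis by (simp only: power_mult[symmetric]) (simp add: mult_ac)
  qed
  finally have "real ((card (dyadics r) choose l)\<^sup>2) \<le> real (2 ^ (4 * r * l))" by (rule of_nat_mono)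
  also have "\<dots> \<le> exp 1 ^ (4 * r * l)"
    using exp_ge_add_one_self[of 1] by (simp add: power_mono)
  also have "\<dots> = exp (real (4 * r * l))" by (simp add: exp_of_nat_mult[symmetric])
  finally have choose_upper: "real ((card (dyadics r) choose l)\<^sup>2) \<le> exp (real (4 * r * l))" .
  have "real ((card (dyadics r) choose l)\<^sup>2) * q ^ l\<^sup>2 \<le> exp (real (4 * r * l)) * exp (- real (l * (4 * r + 1)))"
    using choose_upper q_upper q0 by (intro mult_mono) auto
  also have "\<dots> = exp (- real l)" by (simp add: exp_add[symmetric] algebra_simps)
  also have "\<dots> \<le> exp (- ((real r + 1) / 4) + - 1)"
  proof -
    have "r + 2 \<le> l" unfolding l_def by simp
    then have "real r + 2 \<le> real l" by linarith
    moreover have "(real r + 1) / 4 \<le> real r + 1" by simp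
    ultimately show ?thesis unfolding exp_le_cancel_iff by linarith
  qed
  also have "\<dots> = exp (- ((real r + 1) / 4)) * exp (- 1)" by (rule exp_add)
  also have "\<dots> \<le> exp (- ((real r + 1) / 4)) * (1 / 2)"
    using exp_ge_add_one_self[of 1] by (intro mult_left_mono) (auto simp: exp_minus field_simps)
  also have "\<dots> \<le> q ^ (r + 1)\<^sup>2 / 2" using q_lower by simp
  finally have small: "real ((card (dyadics r) choose l)\<^sup>2) * q ^ l\<^sup>2 \<le> q ^ (r + 1)\<^sup>2 / 2" .
  from ex_dense_dyadic_matrix[OF Q1 small[unfolded q_def]] obtain A where
    A: "A \<subseteq> {..<N} \<times> {..<N}" "\<not> grid l A" and cA: "4 ^ r * q ^ (r + 1)\<^sup>2 / 4 \<le> real (card A)"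
    unfolding q_def N_def by blast
  have N0: "N > 0" unfolding N_def by simp
  \<comment> \<open>The factor 16 pays for the \<open>16 ^ N\<close> lost between matrices and
    permutations; \<open>M\<close> will bound the average number of cells per row from
    below.\<close>
  define M where "M = 16 * 2 powr (real r / 4)"
  have "M = exp (4 * ln 2 + real r / 4 * ln 2)"
  proof -
    have "exp (4 * ln 2) = (16 :: real)" using exp_of_nat_mult[of 4 "ln (2::real)"] by simp
    then show ?thesis unfolding M_def powr_def by (simp add: exp_add)
  qed
  also have "\<dots> \<le> exp (real r * ln 2 + - ((real r + 1) / 4) + - (2 * ln 2))"
  proof -
    \<comment> \<open>With \<open>ln 2\<close> replaced by \<open>1 / 2\<close> the remaining
      inequality becomes \<open>real r / 8 \<ge> 13 / 4\<close>, the source of the hypothesis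
      \<open>r \<ge> 26\<close>.\<close>
    have "ln (1 / 2) \<le> 1 / 2 - (1::real)" by (rule ln_le_minus_one) simp
    then have "1 / 2 \<le> ln (2::real)" by (simp add: ln_div)
    then have "(3 / 4 * real r - 6) * (1 / 2) \<le> (3 / 4 * real r - 6) * ln 2"
      using r by (intro mult_left_mono) auto
    also have "\<dots> = 3 / 4 * (real r * ln 2) - 6 * ln 2" by (simp add: left_diff_distrib)
    finally have "(3 / 4 * real r - 6) * (1 / 2) \<le> 3 / 4 * (real r * ln 2) - 6 * ln 2" .
    moreover have "real r / 4 * ln 2 = (real r * ln 2) / 4" by simp
    moreover have "real r \<ge> 26" using r by simp
    ultimately show ?thesis unfolding exp_le_cancel_iff by argo
  qed
  also have "\<dots> = 2 ^ r * exp (- ((real r + 1) / 4)) / 4"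
  proof -
    have "exp (real r * ln 2) = (2::real) ^ r" using exp_of_nat_mult[of r "ln (2::real)"] by simp
    moreover have "exp (- (2 * ln 2)) = (1 / 4 :: real)"
      using exp_of_nat_mult[of 2 "ln (2::real)"] by (simp add: exp_minus)
    ultimately show ?thesis unfolding exp_add by simp
  qed
  also have "\<dots> \<le> 2 ^ r * q ^ (r + 1)\<^sup>2 / 4" using q_lower by simp
  finally have "real N * M \<le> real N * (2 ^ r * q ^ (r + 1)\<^sup>2 / 4)" by (intro mult_left_mono) auto
  also have "\<dots> = 4 ^ r * q ^ (r + 1)\<^sup>2 / 4"
  proof -
    have "(4::real) ^ r = 2 ^ r * 2 ^ r" by (simp flip: power_mult_distrib)
    then show ?thesis unfolding N_def by simp
  qed
  also note cA
  finally have M: "M \<le> real (card A) / real N" using N0 by (simp add: field_simps)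
  have M1: "M \<ge> 1" unfolding M_def using ge_one_powr_ge_zero[of 2 "real r / 4"] by simp
  then have "1 \<le> real (card A) / real N" using M by linarith
  then have NA: "N \<le> card A" using N0 by (simp add: field_simps)
  have "16 ^ N * (2 powr (real r / 4)) ^ N = M ^ N" unfolding M_def by (simp add: power_mult_distrib)
  also have "\<dots> \<le> (real (card A) / real N) ^ N" using M M1 by (intro power_mono) auto
  also have "\<dots> \<le> real (card A choose N)" using NA by (rule binomial_ge_n_over_k_pow_k)
  also have "\<dots> \<le> real (card {\<sigma>. \<sigma> permutes {1..N} \<and> \<not> grid (3 * l) (perm_points N \<sigma>)} * 16 ^ N)"
    using card_grid_free_perms_ge[OF A] by (rule of_nat_mono)
  finally show ?thesis by simp
qed

definition scale :: "nat \<Rightarrow> real" where "scale k = (real k / log 2 (real k)) powr (1 / 4)"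
text \<open>The divisor 16 keeps \<open>grid_size k\<close>, with leading term
  \<open>48 * (level k)\<^sup>2\<close>, at most \<open>(scale k)\<^sup>2 / 4\<close>. Its square is
  then at most \<open>k / (16 * log 2 k)\<close>, small enough for a typical permutation to meet all
  boxes.\<close>

definition level :: "nat \<Rightarrow> nat" where "level k = nat \<lfloor>scale k / 16\<rfloor>"
definition grid_size :: "nat \<Rightarrow> nat" where "grid_size k = 3 * ((4 * level k + 5) * (4 * level k + 1))"
definition pattern_set :: "nat \<Rightarrow> (nat \<Rightarrow> nat) set" where
  "pattern_set k = typical (k div grid_size k) (grid_size k) k"

lemma scale_at_top: "filterlim scale at_top at_top"
  unfolding scale_def by real_asymp

text \<open>Rounding down loses at most a factor of two, hence \<open>scale k / 32\<close>; the
  threshold 900 exceeds \<open>32 * 26\<close>, so that the level reaches 26.\<close>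

lemma parameter_bounds:
  assumes X: "scale k \<ge> 900"
  shows "k \<ge> 2" "scale k / 32 \<le> real (level k)" "level k \<ge> 26"
    "scale k / 32 \<le> real (grid_size k)" "(real (grid_size k))\<^sup>2 \<le> real k / (16 * log 2 (real k))"
    "grid_size k \<ge> 2" "(grid_size k)\<^sup>2 \<le> k"
proof -
  have "scale 0 = 0" "scale 1 = 0" unfolding scale_def by simp_all
  then have "k \<noteq> 0" "k \<noteq> 1" using X by (metis not_numeral_le_zero)+
  then show k: "k \<ge> 2" by simp
  then have lg: "log 2 (real k) \<ge> 1" by (simp add: le_log_iff)
  show lev: "scale k / 32 \<le> real (level k)" using X unfolding level_def by linarith
  then show lev_ge: "level k \<ge> 26" using X by linarith
  have "real (level k) \<le> real (grid_size k)" unfolding grid_size_def by simp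
  then show "scale k / 32 \<le> real (grid_size k)" using lev by linarith
  have levu: "real (level k) \<le> scale k / 16" using X unfolding level_def by linarith
  have "real (grid_size k) = 48 * (real (level k))\<^sup>2 + 72 * real (level k) + 15"
    unfolding grid_size_def by (simp add: power2_eq_square algebra_simps)
  also have "\<dots> \<le> 52 * (real (level k))\<^sup>2"
  proof -
    have "26 * real (level k) \<le> real (level k) * real (level k)"
      using lev_ge by (intro mult_right_mono) auto
    moreover have "26 \<le> real (level k)" using lev_ge by simp
    ultimately show ?thesis unfolding power2_eq_square by linarith
  qed
  also have "\<dots> \<le> 52 * (scale k / 16)\<^sup>2" using levu by (intro mult_left_mono power_mono) auto
  also have "\<dots> \<le> (scale k)\<^sup>2 / 4" by (simp add: power2_eq_square)
  finally have "(real (grid_size k))\<^sup>2 \<le> ((scale k)\<^sup>2 / 4)\<^sup>2" by (intro power_mono) auto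
  also have "\<dots> = (scale k) ^ 4 / 16" by (simp add: power2_eq_square power4_eq_xxxx)
  also have "(scale k) ^ 4 = real k / log 2 (real k)"
  proof -
    have "real k / log 2 (real k) > 0" using k lg by simp
    moreover have "(y powr (1 / 4)) ^ 4 = y" if "y > 0" for y :: real
      using powr_realpow[of "y powr (1 / 4)" 4] that by (simp add: powr_powr)
    ultimately show ?thesis unfolding scale_def by blast
  qed
  finally show sq: "(real (grid_size k))\<^sup>2 \<le> real k / (16 * log 2 (real k))" by simp
  show "grid_size k \<ge> 2" unfolding grid_size_def by simp
  have "real k / (16 * log 2 (real k)) \<le> real k / 1" using lg by (intro divide_left_mono) auto
  then have "real ((grid_size k)\<^sup>2) \<le> real k" using sq unfolding of_nat_power by linarith
  then show "(grid_size k)\<^sup>2 \<le> k" by (simp only: of_nat_le_iff)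
qed

text \<open>The box side \<open>b\<close> is at least \<open>k / (2 * l)\<close>, which makes
  \<open>b\<^sup>2 / k\<close> at least \<open>2 * ln k\<close>. A box is then missed with
  probability at most \<open>1 / k\<^sup>2\<close>, and at most \<open>k\<close> boxes give the term
  \<open>1 / k\<close>. The end conditions cost at most \<open>1 / l\<close> and
  \<open>2 / l\<close>; since \<open>l\<close> is at least \<open>scale k / 32\<close>, this gives
  \<open>96 / scale k\<close>.\<close>

lemma card_pattern_set_ge:
  assumes X: "scale k \<ge> 900"
  shows "1 - (1 / real k + 96 / scale k) \<le> real (card (pattern_set k)) / fact k"
proof -
  define l where "l = grid_size k"
  define b where "b = k div l"
  note P = parameter_bounds[OF X, folded l_def]
  have k0: "real k > 0" and l0: "real l > 0" using P by auto
  have lk: "real l * real l \<le> real k" using P(7) by (metis of_nat_le_iff of_nat_mult power2_eq_square)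
  have lb: "l * b \<le> k" unfolding b_def by simp
  have bl: "real k < real l * real b + real l"
  proof -
    have "k < l * b + l" unfolding b_def using P(6) mod_less_divisor[of l k] mult_div_mod_eq[of l k] by linarith
    then show ?thesis by (metis of_nat_less_iff of_nat_add of_nat_mult)
  qed
  have lg: "log 2 (real k) \<ge> 1" using P(1) by (simp add: le_log_iff)
  have "real k / (2 * real l) \<le> real b"
  proof -
    have "2 * real l \<le> real l * real l" using P(6) by (intro mult_right_mono) auto
    then have "real k \<le> 2 * (real l * real b)" using bl lk by linarith
    then show ?thesis using l0 by (simp add: field_simps)
  qed
  then have "(real k / (2 * real l))\<^sup>2 / real k \<le> (real b)\<^sup>2 / real k"
    using k0 l0 by (intro divide_right_mono power_mono) auto
  moreover have "(real k / (2 * real l))\<^sup>2 / real k = real k / (4 * (real l)\<^sup>2)"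
    using k0 l0 by (simp add: power2_eq_square field_simps)
  moreover have "4 * log 2 (real k) \<le> real k / (4 * (real l)\<^sup>2)"
    using P(5) l0 lg by (simp add: field_simps)
  moreover have "ln (real k) \<le> log 2 (real k)"
    unfolding log_def using P(1) ln_2_less_1 by (simp add: field_simps mult_left_le)
  ultimately have b2: "2 * ln (real k) \<le> (real b)\<^sup>2 / real k" using lg by linarith
  have bk: "real b \<le> real k" unfolding b_def by simp
  have "(1 - real b / real k) ^ b \<le> exp (- (real b / real k)) ^ b"
    using bk k0 exp_ge_add_one_self[of "- (real b / real k)"] by (intro power_mono) auto
  also have "\<dots> = exp (- ((real b)\<^sup>2 / real k))"
    by (simp add: exp_of_nat_mult[symmetric] power2_eq_square)
  also have "\<dots> \<le> exp (- (2 * ln (real k)))" using b2 by simp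
  also have "\<dots> = 1 / (real k * real k)"
    using k0 by (simp add: exp_minus exp_double power2_eq_square divide_inverse)
  finally have "real (l\<^sup>2) * (1 - real b / real k) ^ b \<le> real k * (1 / (real k * real k))"
    using lk bk k0 by (intro mult_mono) (auto simp: power2_eq_square)
  then have t1: "real (l\<^sup>2) * (1 - real b / real k) ^ b \<le> 1 / real k" using k0 by simp
  have t2: "real b / real k \<le> 1 / real l"
  proof -
    have "real l * real b \<le> real k" using lb by (metis of_nat_le_iff of_nat_mult)
    then show ?thesis using l0 k0 by (simp add: field_simps)
  qed
  have t3: "1 - real ((l - 1) * b) / real k \<le> 1 / real l + 1 / real l"
  proof -
    have "real ((l - 1) * b) = real l * real b - real b" using P(6) by (simp add: of_nat_diff algebra_simps)
    then have "real k - real ((l - 1) * b) \<le> real l + real b" using bl by simp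
    then have "(real k - real ((l - 1) * b)) / real k \<le> (real l + real b) / real k"
      using k0 by (intro divide_right_mono) auto
    moreover have "real l / real k \<le> 1 / real l" using lk l0 k0 by (simp add: field_simps)
    ultimately show ?thesis using t2 k0 by (simp add: diff_divide_distrib add_divide_distrib)
  qed
  have "1 / real l \<le> 1 / (scale k / 32)" using P(4) X by (intro divide_left_mono) auto
  then have t4: "3 / real l \<le> 96 / scale k" using X l0 by (simp add: field_simps)
  have "fact k * (1 - (real (l\<^sup>2) * (1 - real b / real k) ^ b + real b / real k + (1 - real ((l - 1) * b) / real k)))
      \<le> real (card (pattern_set k))"
    unfolding pattern_set_def l_def[symmetric] b_def[symmetric]
    using lb P(1,6) by (intro card_typical_ge) auto
  then have "1 - (real (l\<^sup>2) * (1 - real b / real k) ^ b + real b / real k + (1 - real ((l - 1) * b) / real k))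
      \<le> real (card (pattern_set k)) / fact k" by (simp add: field_simps)
  moreover have "3 / real l = 1 / real l + (1 / real l + 1 / real l)" by simp
  ultimately show ?thesis using t1 t2 t3 t4 by linarith
qed

lemma pattern_set_permutes: "pattern_set k \<subseteq> {\<pi>. \<pi> permutes {1..k}}"
  unfolding pattern_set_def typical_def by blast

lemma card_pattern_set_le: "real (card (pattern_set k)) / fact k \<le> 1"
proof -
  have "card (pattern_set k) \<le> card {\<pi>. \<pi> permutes {1..k}}"
    using pattern_set_permutes by (intro card_mono finite_permutations) auto
  then have "card (pattern_set k) \<le> fact k" by (simp add: card_permutations)
  then have "real (card (pattern_set k)) \<le> fact k" by (metis of_nat_fact of_nat_le_iff)
  then show ?thesis by simp
qed

text \<open>All patterns have a grid of size \<open>grid_size k\<close>, so the permutations of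
  length \<open>2 ^ level k\<close> without such a grid are avoiders, and the limit dominates the
  corresponding root of their number.\<close>

lemma pattern_set_limit:
  assumes X: "scale k \<ge> 900"
  shows "\<exists>L. (\<lambda>n. real (num_avoiders k (pattern_set k) n) powr (1 / real n)) \<longlonglongrightarrow> L \<and>
    2 powr (1 / 128 * scale k) \<le> L"
proof -
  note P = parameter_bounds[OF X]
  have lb: "grid_size k * (k div grid_size k) \<le> k" by simp
  have ind: "indec k \<pi>" if "\<pi> \<in> pattern_set k" for \<pi>
    using that lb P(6) unfolding pattern_set_def by (rule indec_typical)
  \<comment> \<open>The pattern set is nonempty because \<open>1 - (1 / 2 + 1 / 4) > 0\<close>; a
    member is required for the finite upper bound on the growth rate.\<close>
  have "1 / real k \<le> 1 / 2" using P(1) by simp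
  moreover have "96 / scale k \<le> 1 / 4" using X by (simp add: field_simps)
  ultimately have "real (card (pattern_set k)) / fact k > 0" using card_pattern_set_ge[OF X] by linarith
  then have "pattern_set k \<noteq> {}" by auto
  then obtain \<pi> where \<pi>: "\<pi> \<in> pattern_set k" "\<pi> permutes {1..k}" using pattern_set_permutes by blast
  obtain L where L: "(\<lambda>n. real (num_avoiders k (pattern_set k) n) powr (1 / real n)) \<longlonglongrightarrow> L"
    "\<And>n. n > 0 \<Longrightarrow> real (num_avoiders k (pattern_set k) n) powr (1 / real n) \<le> L"
    using growth_limit[OF ind P(1) \<pi>] by blast
  define r where "r = level k"
  define N :: nat where "N = 2 ^ r"
  have N0: "N > 0" unfolding N_def by simp
  have "{\<sigma>. \<sigma> permutes {1..N} \<and> \<not> grid (grid_size k) (perm_points N \<sigma>)} \<subseteq> avoiders k (pattern_set k) N"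
    unfolding avoiders_def
  proof clarify
    fix \<sigma> \<tau> assume \<sigma>: "\<not> grid (grid_size k) (perm_points N \<sigma>)" and \<tau>: "\<tau> \<in> pattern_set k"
      and "contains_perm N \<sigma> k \<tau>"
    moreover have "grid (grid_size k) (perm_points k \<tau>)"
      using \<tau> lb unfolding pattern_set_def by (rule grid_typical)
    ultimately show False using grid_contains_perm by blast
  qed
  then have "card {\<sigma>. \<sigma> permutes {1..N} \<and> \<not> grid (grid_size k) (perm_points N \<sigma>)} \<le> num_avoiders k (pattern_set k) N"
    unfolding num_avoiders_def avoiders_def[symmetric] using finite_avoiders by (intro card_mono)
  then have "real (card {\<sigma>. \<sigma> permutes {1..N} \<and> \<not> grid (grid_size k) (perm_points N \<sigma>)})
      \<le> real (num_avoiders k (pattern_set k) N)" by (rule of_nat_mono)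
  moreover have "(2 powr (real r / 4)) ^ N
      \<le> real (card {\<sigma>. \<sigma> permutes {1..N} \<and> \<not> grid (grid_size k) (perm_points N \<sigma>)})"
    using many_grid_free_perms[of r] P(3) unfolding grid_size_def N_def r_def by simp
  ultimately have "(2 powr (real r / 4)) ^ N \<le> real (num_avoiders k (pattern_set k) N)" by linarith
  then have "((2 powr (real r / 4)) ^ N) powr (1 / real N) \<le> real (num_avoiders k (pattern_set k) N) powr (1 / real N)"
    by (intro powr_mono2) auto
  also have "\<dots> \<le> L" using L(2) N0 .
  also have "((2 powr (real r / 4)) ^ N) powr (1 / real N) = 2 powr (real r / 4)"
    using N0 by (simp add: powr_realpow[symmetric] powr_powr)
  finally have "2 powr (real r / 4) \<le> L" .
  \<comment> \<open>The constant combines the exponent \<open>real r / 4\<close> with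
    \<open>r \<ge> scale k / 32\<close>.\<close>
  moreover have "2 powr (1 / 128 * scale k) \<le> (2::real) powr (real r / 4)"
    using P(2) unfolding r_def by (intro powr_mono) auto
  ultimately show ?thesis using L(1) by (meson order.trans)
qed

theorem theorem2:
  shows "\<exists>(c :: real) (k0 :: nat) (U :: nat \<Rightarrow> (nat \<Rightarrow> nat) set).
    c > 0 \<and> k0 \<ge> 2 \<and>
    (\<forall>k\<ge>k0. U k \<subseteq> {\<pi>. \<pi> permutes {1..k}}) \<and>
    (\<lambda>k. real (card (U k)) / fact k) \<longlonglongrightarrow> 1 \<and>
    (\<forall>k\<ge>k0. \<exists>L :: real.
       (\<lambda>n. real (num_avoiders k (U k) n) powr (1 / real n)) \<longlonglongrightarrow> L \<and>
       L \<ge> 2 powr (c * (real k / log 2 (real k)) powr (1 / 4)))"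
proof -
  have ev: "eventually (\<lambda>k. scale k \<ge> 900) sequentially"
    using scale_at_top by (auto simp: filterlim_at_top)
  then obtain k1 where k1: "\<And>k. k \<ge> k1 \<Longrightarrow> scale k \<ge> 900" unfolding eventually_sequentially by blast
  have "(\<lambda>k. real (card (pattern_set k)) / fact k) \<longlonglongrightarrow> 1"
  proof (rule tendsto_sandwich)
    show "eventually (\<lambda>k. 1 - (1 / real k + 96 / scale k) \<le> real (card (pattern_set k)) / fact k) sequentially"
      using ev by (rule eventually_mono) (rule card_pattern_set_ge)
    show "eventually (\<lambda>k. real (card (pattern_set k)) / fact k \<le> 1) sequentially"
      using card_pattern_set_le by simp
    have "(\<lambda>k. 96 / scale k) \<longlonglongrightarrow> 0"
      by (rule tendsto_divide_0[OF tendsto_const filterlim_at_top_imp_at_infinity[OF scale_at_top]])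
    then have "(\<lambda>k. 1 - (1 / real k + 96 / scale k)) \<longlonglongrightarrow> 1 - (0 + 0)"
      by (intro tendsto_intros lim_1_over_n)
    then show "(\<lambda>k. 1 - (1 / real k + 96 / scale k)) \<longlonglongrightarrow> 1" by simp
  qed (rule tendsto_const)
  moreover have "\<forall>k\<ge>max 2 k1. \<exists>L. (\<lambda>n. real (num_avoiders k (pattern_set k) n) powr (1 / real n)) \<longlonglongrightarrow> L \<and>
      2 powr (1 / 128 * (real k / log 2 (real k)) powr (1 / 4)) \<le> L"
    using pattern_set_limit k1 unfolding scale_def by simp
  ultimately show ?thesis
    using pattern_set_permutes
    by (intro exI[of _ "1 / 128"] exI[of _ "max 2 k1"] exI[of _ pattern_set] conjI) simp_all
qed

end
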